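(* Let $Q=-T\in\mathbb{R}^{N\times N}$, where $T_{ij}=-t_{ij}$ for $i\neq j$, $T_{ii}=\sum_{j\ne i}t_{ij}$, and $t_{ij}=t_{ji}\ge 0$ for all $i\ne j$. Let $H_1(s),\dots,H_N(s)$ be the local agents determined by the local controllers $C_1(s),\dots,C_N(s)$. Suppose one can find a nominal model set $\{H_n(s),\xi\}$, consisting of a transfer function $H_n(s)$ and a number $\xi$ between $0$ and $1$, and controllers $\{C_i(s)\}$ such that, with $\phi_n(s)=1/H_n(s)$ and $\sigma_-(Q)$ the set of negative eigenvalues of $Q$: (i) (stability condition) $\phi_n(s)-\lambda_i\neq 0$ for all $\lambda_i\in\sigma_-(Q)$ and all $s\in\mathbb{C}_+$; (ii) (robust stability condition) $\left\|\dfrac{\lambda_iH_n(s)}{1-\lambda_iH_n(s)}\right\|_\infty\le\dfrac1\xi$ for all $\lambda_i\in\sigma_-(Q)$; (iii) (model matching condition) $\left\|\dfrac{H_i(s)-H_n(s)}{H_n(s)}\right\|_\infty\le\xi$ for all $i=1,\dots,N$. Then the overall load frequency control system is stable. The conditions are only sufficient: if (iii) fails for some local areas, one cannot conclude that the overall system is unstable. Moreover there is a trade-off in $\xi$: as $\xi$ increases towards $1$, (iii) becomes easier to satisfy and (ii) harder; as $\xi$ decreases towards $0$, (iii) becomes harder to satisfy and (ii) easier.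
   Context: $\mathbb{C}_+$ is the closed right half-plane and $\|\cdot\|_\infty$ is the $H_\infty$ norm. In the load frequency control system each area $i$ has a generator $F_i(s)=\frac{1}{M_is+D_i}$ (inertia $M_i$, damping $D_i$), governor and turbine transfer functions $F_{g,i}(s)$ and $F_{t,i}(s)$, droop characteristic $R_i$, frequency bias setting $B_i$ and controller $C_i(s)$, and the local agent is $$H_i(s)=\frac1s\,\frac{\left(1+C_i(s)F_{g,i}(s)F_{t,i}(s)\right)F_i(s)}{1+\left(B_iC_i(s)+\frac{1}{R_i}\right)F_{g,i}(s)F_{t,i}(s)F_i(s)}.$$ The stability of the load frequency control system is determined by that of the multi-agent feedback system $y=\mathrm{diag}\{H_i(s)\}u$, $u=Qy$, i.e. by $\det(I_N-\mathrm{diag}\{H_i(s)\}Q)$.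
   Formalization: Transfer functions are rational and the blocks F_g, F_t, C_i proper; (i)–(iii) give no zero in the open half-plane, and on closed C_+ only where both bounds are attained at that point; stability on closed C_+ is concluded if (ii) or (iii) is strict, since with equality in both it can fail. *)

theory Defs
  imports "HOL-Analysis.Analysis" "HOL-Computational_Algebra.Computational_Algebra"
    "HOL-Computational_Algebra.Field_as_Ring"
begin

text \<open>Transfer functions are elements of the field of real rational functions, so that
  cancellations are exact and no value is attached to a pole. Zeros and poles are read off the
  reduced fraction.\<close>

type_synonym tf = "real poly fract"

definition tf_const :: "real \<Rightarrow> tf" where
  "tf_const c = to_fract [:c:]"

definition tf_s :: tf where
  "tf_s = to_fract [:0, 1:]"

definition tf_num :: "tf \<Rightarrow> complex \<Rightarrow> complex" where
  "tf_num f z = poly (map_poly of_real (fst (quot_of_fract f))) z"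

definition tf_den :: "tf \<Rightarrow> complex \<Rightarrow> complex" where
  "tf_den f z = poly (map_poly of_real (snd (quot_of_fract f))) z"

text \<open>Meaningful only where \<open>z\<close> is not a pole.\<close>

definition tf_eval :: "tf \<Rightarrow> complex \<Rightarrow> complex" where
  "tf_eval f z = tf_num f z / tf_den f z"

text \<open>The zero function has a zero at every point.\<close>

definition tf_zero :: "tf \<Rightarrow> complex \<Rightarrow> bool" where
  "tf_zero f z \<longleftrightarrow> tf_num f z = 0"

definition tf_pole :: "tf \<Rightarrow> complex \<Rightarrow> bool" where
  "tf_pole f z \<longleftrightarrow> tf_den f z = 0"

definition tf_proper :: "tf \<Rightarrow> bool" where
  "tf_proper f \<longleftrightarrow> degree (fst (quot_of_fract f)) \<le> degree (snd (quot_of_fract f))"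

text \<open>The \<open>H\<^sub>\<infinity>\<close> norm, with value \<open>\<infinity>\<close> outside \<open>H\<^sub>\<infinity>\<close>. Poles on the imaginary axis and improper
  functions also give \<open>\<infinity>\<close>, as the supremum over the open half-plane is then unbounded.\<close>

definition hinf_norm :: "tf \<Rightarrow> ereal" where
  "hinf_norm f =
     (if \<exists>z. 0 < Re z \<and> tf_pole f z then \<infinity>
      else (SUP z\<in>{z. 0 < Re z}. ereal (cmod (tf_eval f z))))"

definition closed_rhp :: "complex set" where
  "closed_rhp = {z. 0 \<le> Re z}"

record lfc_area =
  inertia :: real
  damping :: real
  droop :: real
  bias :: real
  governor :: tf
  turbine :: tf

text \<open>Nonzero inertia and properness of the blocks make the denominator of \<open>local_agent\<close>
  a nonzero rational function, so the division there is genuine.\<close>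

definition admissible_area :: "lfc_area \<Rightarrow> bool" where
  "admissible_area a \<longleftrightarrow> inertia a \<noteq> 0 \<and> droop a \<noteq> 0 \<and>
     tf_proper (governor a) \<and> tf_proper (turbine a)"

definition positive_params :: "lfc_area \<Rightarrow> bool" where
  "positive_params a \<longleftrightarrow> 0 < inertia a \<and> 0 < damping a \<and> 0 < droop a \<and> 0 < bias a"

definition generator :: "lfc_area \<Rightarrow> tf" where
  "generator a = 1 / (tf_const (inertia a) * tf_s + tf_const (damping a))"

definition local_agent :: "lfc_area \<Rightarrow> tf \<Rightarrow> tf" where
  "local_agent a C =
     (1 / tf_s) *
     (((1 + C * governor a * turbine a) * generator a) /
      (1 + (tf_const (bias a) * C + 1 / tf_const (droop a)) * governor a * turbine a * generator a))"

definition tie_line_matrix :: "('n \<Rightarrow> 'n \<Rightarrow> real) \<Rightarrow> real ^ 'n ^ 'n::finite" where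
  "tie_line_matrix t = (\<chi> i j. if i = j then (\<Sum>k\<in>UNIV - {i}. t i k) else - t i j)"

definition negative_eigenvalues :: "real ^ 'n ^ 'n::finite \<Rightarrow> real set" where
  "negative_eigenvalues Q = {l. l < 0 \<and> (\<exists>v. v \<noteq> 0 \<and> Q *v v = l *s v)}"

definition diag_tf :: "('n \<Rightarrow> tf) \<Rightarrow> tf ^ 'n ^ 'n::finite" where
  "diag_tf H = (\<chi> i j. if i = j then H i else 0)"

definition char_fun :: "('n \<Rightarrow> tf) \<Rightarrow> real ^ 'n ^ 'n::finite \<Rightarrow> tf" where
  "char_fun H Q = det (mat 1 - diag_tf H ** map_matrix tf_const Q)"

definition lfc_stable :: "('n \<Rightarrow> tf) \<Rightarrow> real ^ 'n ^ 'n::finite \<Rightarrow> bool" where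
  "lfc_stable H Q \<longleftrightarrow> (\<forall>z\<in>closed_rhp. \<not> tf_zero (char_fun H Q) z)"

text \<open>Zeros on the imaginary axis are tolerated here, but not in \<open>lfc_stable\<close>.\<close>

definition lfc_marginally_stable :: "('n \<Rightarrow> tf) \<Rightarrow> real ^ 'n ^ 'n::finite \<Rightarrow> bool" where
  "lfc_marginally_stable H Q \<longleftrightarrow> (\<forall>z. 0 < Re z \<longrightarrow> \<not> tf_zero (char_fun H Q) z)"

definition comp_sens :: "tf \<Rightarrow> real \<Rightarrow> tf" where
  "comp_sens Hn l = (tf_const l * Hn) / (1 - tf_const l * Hn)"

definition rel_error :: "tf \<Rightarrow> tf \<Rightarrow> tf" where
  "rel_error Hn H = (H - Hn) / Hn"

definition stability_cond :: "real ^ 'n ^ 'n::finite \<Rightarrow> tf \<Rightarrow> bool" where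
  "stability_cond Q Hn \<longleftrightarrow>
     (\<forall>l\<in>negative_eigenvalues Q. \<forall>z\<in>closed_rhp. \<not> tf_zero (1 / Hn - tf_const l) z)"

definition robust_stability_cond :: "real ^ 'n ^ 'n::finite \<Rightarrow> tf \<Rightarrow> real \<Rightarrow> bool" where
  "robust_stability_cond Q Hn \<xi> \<longleftrightarrow>
     (\<forall>l\<in>negative_eigenvalues Q. hinf_norm (comp_sens Hn l) \<le> ereal (1 / \<xi>))"

definition model_matching_cond :: "('n \<Rightarrow> tf) \<Rightarrow> tf \<Rightarrow> real \<Rightarrow> bool" where
  "model_matching_cond H Hn \<xi> \<longleftrightarrow> (\<forall>i. hinf_norm (rel_error Hn (H i)) \<le> ereal \<xi>)"

end

theory Submission
  imports Defs "HOL-Complex_Analysis.Complex_Analysis" "HOL-Real_Asymp.Real_Asymp"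
begin

text \<open>Diagonalise the symmetric \<open>Q = P diag(\<lambda>\<^sub>k) P\<^sup>T\<close> and put \<open>\<Delta>\<^sub>i = (H\<^sub>i - H\<^sub>n) / H\<^sub>n\<close> and
  \<open>T\<^sub>k = \<lambda>\<^sub>k H\<^sub>n / (1 - \<lambda>\<^sub>k H\<^sub>n)\<close>. Then
  \<open>I - diag(H\<^sub>i) Q = (I - diag(\<Delta>\<^sub>i) P diag(T\<^sub>k) P\<^sup>T) P diag(1 - \<lambda>\<^sub>k H\<^sub>n) P\<^sup>T\<close>, where the last
  factor has no zero in the closed right half-plane. The first factor is singular at a point only if
  \<open>max \<bar>\<Delta>\<^sub>i\<bar> * max \<bar>T\<^sub>k\<bar> \<ge> 1\<close> there, so a zero forces both bounds \<open>\<xi>\<close> and \<open>1/\<xi>\<close> to be attained.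
  Inside the half-plane the maximum modulus principle would make the attaining \<open>T\<^sub>k\<close> constant, but
  \<open>T\<^sub>k\<close> vanishes at infinity together with \<open>H\<^sub>i\<close> and \<open>H\<^sub>n\<close>.\<close>

no_notation fps_nth (infixl \<open>$\<close> 75)

section \<open>Evaluation of rational functions\<close>

definition cpoly :: "real poly \<Rightarrow> complex \<Rightarrow> complex" where
  "cpoly p z = poly (map_poly of_real p) z"

lemma cpoly_simps [simp]:
  "cpoly 0 z = 0" "cpoly 1 z = 1" "cpoly [:c:] z = of_real c"
  by (simp_all add: cpoly_def map_poly_pCons)

lemma cpoly_pCons [simp]: "cpoly (pCons c p) z = of_real c + z * cpoly p z"
  by (simp add: cpoly_def map_poly_pCons)

lemma cpoly_add [simp]: "cpoly (p + q) z = cpoly p z + cpoly q z"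
proof -
  have "map_poly of_real (p + q) = (map_poly of_real p + map_poly of_real q :: complex poly)"
    by (intro poly_eqI) (simp add: coeff_map_poly)
  then show ?thesis by (simp add: cpoly_def)
qed

lemma cpoly_smult [simp]: "cpoly (smult c p) z = of_real c * cpoly p z"
  by (induction p) (simp_all add: algebra_simps)

lemma cpoly_mult [simp]: "cpoly (p * q) z = cpoly p z * cpoly q z"
  by (induction p) (simp_all add: algebra_simps)

text \<open>At a common root of the reduced numerator and denominator, a Bezout identity for these
  coprime real polynomials, evaluated at \<open>z\<close>, would read 0 = 1.\<close>

lemma tf_num_den_coprime:
  assumes "tf_num f z = 0" shows "tf_den f z \<noteq> 0"
proof -
  define a b where "a = fst (quot_of_fract f)" and "b = snd (quot_of_fract f)"
  have "coprime a b" unfolding a_def b_def by (rule coprime_quot_of_fract)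
  obtain x y where "x * a + y * b = gcd a b"
    using bezout_coefficients[of a b] by (metis prod.exhaust)
  then have "cpoly (x * a + y * b) z = 1"
    using \<open>coprime a b\<close> by simp
  then show ?thesis
    using assms by (auto simp: tf_num_def tf_den_def a_def b_def cpoly_def[symmetric])
qed

text \<open>Since \<open>to_fract\<close> is injective, cross-multiplying gives an identity of
  polynomials. It can be evaluated at every point, roots of either denominator included.\<close>

lemma tf_cross:
  assumes "q \<noteq> 0" "f = to_fract p / to_fract q"
  shows "fst (quot_of_fract f) * q = p * snd (quot_of_fract f)"
proof -
  have "to_fract (fst (quot_of_fract f)) / to_fract (snd (quot_of_fract f)) = f"
    by (metis Fract_conv_to_fract Fract_quot_of_fract)
  with assms have "to_fract (fst (quot_of_fract f) * q) = to_fract (p * snd (quot_of_fract f))"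
    by (simp add: field_simps)
  then show ?thesis by (simp only: to_fract_eq_iff)
qed

lemma tf_repr: "f = to_fract (fst (quot_of_fract f)) / to_fract (snd (quot_of_fract f))"
  by (metis Fract_conv_to_fract Fract_quot_of_fract)

text \<open>Values may be computed from any fraction whose denominator does not vanish at
  \<open>z\<close>, reduced or not. A root of the reduced denominator would, by the cross-multiplied
  identity, also be a root of the reduced numerator, against coprimality. The arithmetic rules for
  \<open>tf_eval\<close> rest on this.\<close>

lemma tf_eval_quotient:
  assumes q: "cpoly q z \<noteq> 0"
  shows "\<not> tf_pole (to_fract p / to_fract q) z"
    and "tf_eval (to_fract p / to_fract q) z = cpoly p z / cpoly q z"
proof -
  define f where "f = to_fract p / to_fract q"
  have "q \<noteq> 0" using q by auto
  from tf_cross[OF this f_def]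
  have "cpoly (fst (quot_of_fract f) * q) z = cpoly (p * snd (quot_of_fract f)) z" by simp
  then have eq: "tf_num f z * cpoly q z = cpoly p z * tf_den f z"
    by (simp add: tf_num_def tf_den_def cpoly_def[symmetric])
  show np: "\<not> tf_pole (to_fract p / to_fract q) z"
    using eq q tf_num_den_coprime[of f z] by (auto simp: tf_pole_def f_def[symmetric])
  show "tf_eval (to_fract p / to_fract q) z = cpoly p z / cpoly q z"
    using eq q np by (simp add: tf_pole_def tf_eval_def f_def[symmetric] field_simps)
qed

lemma tf_repr_at:
  assumes "\<not> tf_pole f z"
  obtains p q where "cpoly q z \<noteq> 0" "f = to_fract p / to_fract q" "q \<noteq> 0"
proof (rule that)
  show "cpoly (snd (quot_of_fract f)) z \<noteq> 0"
    using assms by (simp add: tf_pole_def tf_den_def cpoly_def)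
  then show "snd (quot_of_fract f) \<noteq> 0" by auto
qed (rule tf_repr)

lemma tf_eval_add:
  assumes "\<not> tf_pole f z" "\<not> tf_pole g z"
  shows "\<not> tf_pole (f + g) z \<and> tf_eval (f + g) z = tf_eval f z + tf_eval g z"
proof -
  obtain p q where pq: "cpoly q z \<noteq> 0" "f = to_fract p / to_fract q" "q \<noteq> 0"
    using tf_repr_at[OF assms(1)] .
  obtain r s where rs: "cpoly s z \<noteq> 0" "g = to_fract r / to_fract s" "s \<noteq> 0"
    using tf_repr_at[OF assms(2)] .
  have eq: "f + g = to_fract (p * s + r * q) / to_fract (q * s)"
    using pq rs by (simp add: field_simps)
  have qs: "cpoly (q * s) z \<noteq> 0" using pq rs by simp
  from pq rs have "tf_eval f z = cpoly p z / cpoly q z" "tf_eval g z = cpoly r z / cpoly s z"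
    by (simp_all add: tf_eval_quotient)
  then show ?thesis
    using pq(1) rs(1) tf_eval_quotient[OF qs, of "p * s + r * q"] unfolding eq
    by (simp add: add_frac_eq mult.commute)
qed

lemma tf_eval_mult:
  assumes "\<not> tf_pole f z" "\<not> tf_pole g z"
  shows "\<not> tf_pole (f * g) z \<and> tf_eval (f * g) z = tf_eval f z * tf_eval g z"
proof -
  obtain p q where pq: "cpoly q z \<noteq> 0" "f = to_fract p / to_fract q" "q \<noteq> 0"
    using tf_repr_at[OF assms(1)] .
  obtain r s where rs: "cpoly s z \<noteq> 0" "g = to_fract r / to_fract s" "s \<noteq> 0"
    using tf_repr_at[OF assms(2)] .
  have "f * g = to_fract (p * r) / to_fract (q * s)"
    using pq rs by simp
  then show ?thesis
    using pq rs tf_eval_quotient[of "q * s" z "p * r"]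
    by (simp add: tf_eval_quotient)
qed

lemma tf_eval_poly [simp]: "\<not> tf_pole (to_fract p) z" "tf_eval (to_fract p) z = cpoly p z"
  using tf_eval_quotient[of 1 z p] by simp_all

lemma tf_eval_const [simp]: "\<not> tf_pole (tf_const c) z" "tf_eval (tf_const c) z = of_real c"
  by (simp_all add: tf_const_def)

lemma tf_eval_0 [simp]: "\<not> tf_pole 0 z" "tf_eval 0 z = 0"
  using tf_eval_poly[of 0 z] by simp_all

lemma tf_eval_1 [simp]: "\<not> tf_pole 1 z" "tf_eval 1 z = 1"
  using tf_eval_poly[of 1 z] by simp_all

lemma tf_eval_uminus:
  assumes "\<not> tf_pole f z"
  shows "\<not> tf_pole (- f) z \<and> tf_eval (- f) z = - tf_eval f z"
proof -
  have "[:- 1:] = (- 1 :: real poly)" by (simp add: one_pCons)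
  then have "tf_const (- 1) * f = - f"
    unfolding tf_const_def by (simp only: to_fract_uminus to_fract_1 mult_minus_left mult_1)
  with tf_eval_mult[OF tf_eval_const(1)[of "- 1" z] assms] show ?thesis by simp
qed

lemma tf_eval_diff:
  assumes "\<not> tf_pole f z" "\<not> tf_pole g z"
  shows "\<not> tf_pole (f - g) z \<and> tf_eval (f - g) z = tf_eval f z - tf_eval g z"
  using tf_eval_add[OF assms(1), of "- g"] tf_eval_uminus[OF assms(2)] by simp

text \<open>At a pole \<open>tf_eval\<close> is 0 by the convention for division by zero, so the
  absence of a pole has to be stated next to the vanishing value.\<close>

lemma tf_zero_iff: "tf_zero f z \<longleftrightarrow> \<not> tf_pole f z \<and> tf_eval f z = 0"
  using tf_num_den_coprime[of f z] by (auto simp: tf_zero_def tf_pole_def tf_eval_def)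

lemma tf_inverse_regular:
  assumes "\<not> tf_zero f z"
  shows "\<not> tf_pole (inverse f) z" and "\<not> tf_pole f z \<Longrightarrow> tf_eval (inverse f) z = inverse (tf_eval f z)"
proof -
  have a: "cpoly (fst (quot_of_fract f)) z \<noteq> 0"
    using assms by (simp add: tf_zero_def tf_num_def cpoly_def)
  have "inverse f = to_fract (snd (quot_of_fract f)) / to_fract (fst (quot_of_fract f))"
    by (metis tf_repr inverse_divide)
  note e = tf_eval_quotient[OF a, of "snd (quot_of_fract f)", folded this]
  show "\<not> tf_pole (inverse f) z" by (rule e)
  show "tf_eval (inverse f) z = inverse (tf_eval f z)"
    by (simp add: e(2)) (simp add: tf_eval_def tf_num_def tf_den_def cpoly_def)
qed

lemma tf_eval_divide:
  assumes "\<not> tf_pole f z" "\<not> tf_pole g z" "tf_eval g z \<noteq> 0"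
  shows "\<not> tf_pole (f / g) z \<and> tf_eval (f / g) z = tf_eval f z / tf_eval g z"
  using tf_eval_mult[OF assms(1) tf_inverse_regular(1)[of g z]] tf_inverse_regular(2)[of g z] assms
  by (auto simp: tf_zero_iff field_class.field_divide_inverse divide_inverse)

text \<open>If \<open>z\<close> is no zero of \<open>g\<close>, then \<open>inverse g\<close> is
  regular at \<open>z\<close>, and \<open>f = (f * g) * inverse g\<close> vanishes there. Both
  factors may have poles at \<open>z\<close>; this matters because agents and nominal model may have
  poles in the closed half-plane, for instance from the integrator.\<close>

lemma tf_zero_mult:
  assumes "tf_zero (f * g) z" shows "tf_zero f z \<or> tf_zero g z"
proof (rule ccontr)
  assume *: "\<not> (tf_zero f z \<or> tf_zero g z)"
  then have "g \<noteq> 0" by (auto simp: tf_zero_iff)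
  then have "f = (f * g) * inverse g" by simp
  with tf_eval_mult[of "f * g" z "inverse g"] tf_inverse_regular(1)[of g z] assms *
  show False by (auto simp: tf_zero_iff)
qed

lemma tf_zero_prod:
  assumes "finite A" "tf_zero (prod f A) z" shows "\<exists>i\<in>A. tf_zero (f i) z"
  using assms
proof (induction A)
  case empty
  then show ?case by (simp add: tf_zero_iff)
next
  case (insert x F)
  then show ?case using tf_zero_mult[of "f x" "prod f F" z] by auto
qed

lemma tf_const_hom [simp]:
  "tf_const 0 = 0" "tf_const 1 = 1" "tf_const (a + b) = tf_const a + tf_const b"
  "tf_const (a * b) = tf_const a * tf_const b" "tf_const (- a) = - tf_const a"
  "tf_const (a - b) = tf_const a - tf_const b"
  unfolding tf_const_def to_fract_add[symmetric] to_fract_mult[symmetric]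
    to_fract_uminus[symmetric] to_fract_diff[symmetric]
  by (simp_all add: one_pCons[symmetric])

lemma tf_const_eq_0 [simp]: "tf_const a = 0 \<longleftrightarrow> a = 0"
  by (simp add: tf_const_def)

lemma tf_const_divide: "tf_const (a / b) = tf_const a / tf_const b"
proof (cases "b = 0")
  case False
  then have "tf_const (a / b) * tf_const b = tf_const a"
    by (simp flip: tf_const_hom(4))
  with False show ?thesis by (simp add: field_simps)
qed simp

section \<open>Pointwise consequences of norm bounds, regularity and limits\<close>

lemma hinf_norm_le_iff_open:
  "hinf_norm f \<le> ereal K \<longleftrightarrow> (\<forall>z. 0 < Re z \<longrightarrow> \<not> tf_pole f z \<and> cmod (tf_eval f z) \<le> K)"
  by (auto simp: hinf_norm_def SUP_le_iff)

text \<open>The norm only sees the open half-plane. There the bound reads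
  \<open>cmod (n w) \<le> K * cmod (d w)\<close>, which survives the passage to the imaginary axis
  by continuity. A boundary root of the denominator would then be a root of the numerator as well,
  which coprimality forbids.\<close>

lemma hinf_norm_leD:
  assumes "hinf_norm f \<le> ereal K" "0 \<le> Re z"
  shows "\<not> tf_pole f z \<and> cmod (tf_eval f z) \<le> K"
proof -
  define n d where "n = tf_num f" and "d = tf_den f"
  have cont: "continuous_on UNIV n" "continuous_on UNIV d"
    unfolding n_def d_def tf_num_def tf_den_def by (intro continuous_intros)+
  have ev: "cmod (n w) \<le> K * cmod (d w)" if "0 < Re w" for w
  proof -
    have "d w \<noteq> 0" "cmod (n w / d w) \<le> K"
      using assms(1) that unfolding hinf_norm_le_iff_open tf_pole_def tf_eval_def n_def d_def by auto
    then show ?thesis by (simp add: norm_divide divide_le_eq)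
  qed
  define w where "w k = z + of_real (1 / Suc k)" for k
  have "w \<longlonglongrightarrow> z + of_real 0"
    unfolding w_def by (intro tendsto_intros LIMSEQ_Suc lim_1_over_n)
  then have w: "w \<longlonglongrightarrow> z" by simp
  have nl: "(\<lambda>k. n (w k)) \<longlonglongrightarrow> n z" and dl: "(\<lambda>k. d (w k)) \<longlonglongrightarrow> d z"
    using cont w by (auto simp: continuous_on_eq_continuous_at isCont_tendsto_compose)
  have le: "cmod (n z) \<le> K * cmod (d z)"
  proof (rule LIMSEQ_le)
    show "(\<lambda>k. cmod (n (w k))) \<longlonglongrightarrow> cmod (n z)" by (intro tendsto_intros nl)
    show "(\<lambda>k. K * cmod (d (w k))) \<longlonglongrightarrow> K * cmod (d z)" by (intro tendsto_intros dl)
    have "0 < Re (w k)" for k unfolding w_def using assms(2) by (simp add: add_nonneg_pos)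
    then show "\<exists>N. \<forall>k\<ge>N. cmod (n (w k)) \<le> K * cmod (d (w k))" using ev by blast
  qed
  then have "d z \<noteq> 0"
    using tf_num_den_coprime[of f z] by (auto simp: n_def d_def)
  with le show ?thesis
    by (simp add: tf_pole_def tf_eval_def n_def[symmetric] d_def[symmetric] norm_divide divide_le_eq)
qed

lemma hinf_norm_const: "hinf_norm (tf_const c) \<le> ereal K \<longleftrightarrow> \<bar>c\<bar> \<le> K"
  by (auto simp: hinf_norm_le_iff_open intro: exI[of _ 1])

lemma tf_eval_holomorphic:
  assumes "\<And>z. z \<in> S \<Longrightarrow> \<not> tf_pole f z"
  shows "tf_eval f holomorphic_on S"
proof -
  have "(\<lambda>z. tf_num f z / tf_den f z) holomorphic_on S"
    using assms unfolding tf_num_def tf_den_def tf_pole_def by (intro holomorphic_intros) auto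
  then show ?thesis by (simp add: tf_eval_def[abs_def])
qed

lemma tf_regular_at_top: "eventually (\<lambda>x::real. \<not> tf_pole f (of_real x)) at_top"
proof -
  have nz: "map_poly of_real (snd (quot_of_fract f)) \<noteq> (0 :: complex poly)"
    by (subst map_poly_eq_0_iff) auto
  then have "finite {z. tf_pole f z}"
    unfolding tf_pole_def tf_den_def by (rule poly_roots_finite)
  then obtain B where B: "\<And>z. tf_pole f z \<Longrightarrow> cmod z \<le> B"
    using finite_imp_bounded[of "{z. tf_pole f z}"] by (auto simp: bounded_iff)
  show ?thesis
    using eventually_gt_at_top[of "max B 0"] by eventually_elim (use B in force)
qed

text \<open>The limit is 0 if the numerator has smaller degree, and the ratio of the leading
  coefficients if the degrees agree.\<close>

lemma tf_proper_limit:
  assumes "tf_proper f"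
  obtains c where "((\<lambda>x::real. tf_eval f (of_real x)) \<longlongrightarrow> c) at_top"
proof -
  define a b where "a = map_poly complex_of_real (fst (quot_of_fract f))"
    and "b = map_poly complex_of_real (snd (quot_of_fract f))"
  have b0: "b \<noteq> 0" unfolding b_def by (subst map_poly_eq_0_iff) auto
  have deg: "degree a \<le> degree b"
    using assms by (simp add: tf_proper_def a_def b_def degree_map_poly)
  have inf: "filterlim complex_of_real at_infinity at_top"
    by (simp add: filterlim_at_infinity_conv_norm_at_top filterlim_abs_real)
  have "\<exists>c. ((\<lambda>x. poly a x / poly b x) \<longlongrightarrow> c) at_infinity"
  proof (cases "degree a < degree b")
    case True
    then show ?thesis using poly_divide_tendsto_0_at_infinity by blast
  next
    case False
    with deg have eq: "degree a = degree b" by simp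
    have "((\<lambda>x. (poly a x / x ^ degree a) / (poly b x / x ^ degree b))
        \<longlongrightarrow> lead_coeff a / lead_coeff b) at_infinity"
      by (intro tendsto_divide poly_divide_tendsto_aux) (use b0 in simp)
    moreover have "eventually (\<lambda>x. (poly a x / x ^ degree a) / (poly b x / x ^ degree b)
        = poly a x / poly b x) at_infinity"
      by (rule eventually_at_infinityI[of 1]) (auto simp: eq)
    ultimately have "((\<lambda>x. poly a x / poly b x) \<longlongrightarrow> lead_coeff a / lead_coeff b) at_infinity"
      by (rule Lim_transform_eventually)
    then show ?thesis ..
  qed
  then obtain c where "((\<lambda>x. poly a x / poly b x) \<longlongrightarrow> c) at_infinity" ..
  from filterlim_compose[OF this inf] show ?thesis
    by (intro that[of c]) (simp add: tf_eval_def tf_num_def tf_den_def a_def b_def)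
qed

section \<open>Diagonalisation of symmetric matrices\<close>

text \<open>The Rayleigh quotient attains its maximum \<open>m\<close> on the compact unit sphere of
  \<open>S\<close>. At a maximiser \<open>x\<close> the residual \<open>w = f x - m x\<close>, which
  lies in \<open>S\<close> by invariance, must vanish, as otherwise moving \<open>x\<close> in the
  direction \<open>w\<close> would increase the quotient.\<close>

lemma self_adjoint_eigenvector_in_subspace:
  fixes f :: "'a::euclidean_space \<Rightarrow> 'a"
  assumes lin: "linear f" and sym: "\<And>x y. f x \<bullet> y = x \<bullet> f y"
    and S: "subspace S" "f ` S \<subseteq> S" and "y \<in> S" "y \<noteq> 0"
  obtains x l where "x \<in> S" "norm x = 1" "f x = l *\<^sub>R x"
proof -
  let ?U = "S \<inter> sphere 0 1"
  have "compact ?U"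
    using closed_subspace[OF S(1)] compact_sphere by (simp add: closed_Int_compact)
  moreover have "(1 / norm y) *\<^sub>R y \<in> ?U"
    using assms(3,5,6) by (simp add: subspace_scale)
  moreover have "continuous_on ?U (\<lambda>x. x \<bullet> f x)"
    using lin by (intro continuous_on_inner continuous_on_id linear_continuous_on)
      (simp add: linear_conv_bounded_linear)
  ultimately obtain x where x: "x \<in> ?U" and max: "\<And>z. z \<in> ?U \<Longrightarrow> z \<bullet> f z \<le> x \<bullet> f x"
    using continuous_attains_sup[of ?U "\<lambda>x. x \<bullet> f x"] by blast
  define m where "m = x \<bullet> f x"
  have le: "z \<bullet> f z \<le> m * (z \<bullet> z)" if "z \<in> S" for z
  proof (cases "z = 0")
    case False
    have "(1 / norm z) *\<^sub>R z \<bullet> f ((1 / norm z) *\<^sub>R z) \<le> m"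
      unfolding m_def using False that S(1) by (intro max) (simp add: subspace_scale)
    then show ?thesis
      using False by (simp add: linear_scale[OF lin] field_simps power2_eq_square dot_square_norm)
  qed (simp add: linear_0[OF lin])
  define w where "w = f x - m *\<^sub>R x"
  have w: "w \<in> S" using x S unfolding w_def
    by (intro subspace_diff subspace_scale) auto
  have xx: "x \<bullet> x = 1" using x by (simp add: dot_square_norm)
  have "w = 0"
  proof (rule ccontr)
    assume "w \<noteq> 0"
    define c where "c = m * (w \<bullet> w) - w \<bullet> f w"
    \<comment> \<open>The Rayleigh bound at \<open>x + t *\<^sub>R w\<close>: the first-order gain
      in \<open>t\<close> must be dominated by the second-order term.\<close>
    have key: "2 * (w \<bullet> w) \<le> t * c" if "0 < t" for t
    proof -
      have "x + t *\<^sub>R w \<in> S"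
        using x by (intro subspace_add[OF S(1)] subspace_scale[OF S(1)] w) simp
      note le[OF this]
      moreover have "(x + t *\<^sub>R w) \<bullet> f (x + t *\<^sub>R w) =
          m + 2 * t * (w \<bullet> f x) + t * t * (w \<bullet> f w)"
      proof -
        have "x \<bullet> f w = w \<bullet> f x" by (metis sym inner_commute)
        then show ?thesis
          by (simp add: linear_add[OF lin] linear_scale[OF lin] inner_add_left inner_add_right
              m_def distrib_left)
      qed
      moreover have "(x + t *\<^sub>R w) \<bullet> (x + t *\<^sub>R w) =
          1 + 2 * t * (w \<bullet> x) + t * t * (w \<bullet> w)"
        by (simp add: inner_add_left inner_add_right xx inner_commute[of x w] distrib_left)
      ultimately have "m + 2 * t * (w \<bullet> f x) + t * t * (w \<bullet> f w) \<le>
          m * (1 + 2 * t * (w \<bullet> x) + t * t * (w \<bullet> w))"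
        by simp
      then have "t * (2 * (w \<bullet> f x - m * (w \<bullet> x))) \<le> t * (t * c)"
        by (simp add: c_def algebra_simps)
      then have "2 * (w \<bullet> f x - m * (w \<bullet> x)) \<le> t * c" using that by simp
      moreover have "w \<bullet> f x - m * (w \<bullet> x) = w \<bullet> w"
        using arg_cong[OF w_def, of "\<lambda>v. w \<bullet> v"] by (simp add: inner_diff_right)
      ultimately show ?thesis by simp
    qed
    have pos: "0 < w \<bullet> w" using \<open>w \<noteq> 0\<close> by simp
    \<comment> \<open>Positivity of \<open>c\<close> makes \<open>t = (w \<bullet> w) / c\<close>
      admissible, and there \<open>key\<close> says that twice \<open>w \<bullet> w\<close> is at
      most \<open>w \<bullet> w\<close>.\<close>
    then have "0 < c" using key[of 1] by linarith
    with pos key[of "(w \<bullet> w) / c"] show False by simp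
  qed
  then show ?thesis using x that[of x m] by (simp add: w_def)
qed

text \<open>Eigenvectors are added one at a time. The orthogonal complement \<open>S\<close> of
  those found so far is nonzero by dimension, and it is invariant because
  \<open>b \<bullet> f z = f b \<bullet> z = l * (b \<bullet> z)\<close> for an eigenvector
  \<open>b\<close>. It therefore contains a further eigenvector.\<close>

lemma self_adjoint_orthonormal_eigenvectors:
  fixes f :: "'a::euclidean_space \<Rightarrow> 'a"
  assumes lin: "linear f" and sym: "\<And>x y. f x \<bullet> y = x \<bullet> f y"
  shows "k \<le> DIM('a) \<Longrightarrow> \<exists>B. finite B \<and> card B = k \<and> pairwise orthogonal B \<and>
    (\<forall>b\<in>B. norm b = 1 \<and> (\<exists>l. f b = l *\<^sub>R b))"
proof (induction k)
  case 0
  show ?case by (intro exI[of _ "{}"]) auto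
next
  case (Suc k)
  then obtain B where B: "finite B" "card B = k" "pairwise orthogonal B"
    "\<And>b. b \<in> B \<Longrightarrow> norm b = 1" and ev: "\<And>b. b \<in> B \<Longrightarrow> \<exists>l. f b = l *\<^sub>R b"
    by auto
  have "dim (span B) < DIM('a)"
    using B(2) Suc.prems dim_le_card'[OF B(1)] by simp
  then obtain y where y: "y \<noteq> 0" "\<And>b. b \<in> span B \<Longrightarrow> orthogonal y b"
    using orthogonal_to_subspace_exists[of B] by (metis dim_span)
  define S where "S = {z. \<forall>b\<in>B. orthogonal b z}"
  have S: "subspace S"
    unfolding S_def by (rule subspace_orthogonal_to_vectors)
  have "f ` S \<subseteq> S"
  proof (clarsimp simp: S_def orthogonal_def)
    fix z b assume "\<forall>b\<in>B. b \<bullet> z = 0" "b \<in> B"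
    moreover obtain l where "f b = l *\<^sub>R b" using ev[OF \<open>b \<in> B\<close>] ..
    ultimately show "b \<bullet> f z = 0" by (simp flip: sym)
  qed
  moreover have "y \<in> S"
    using y(2) by (auto simp: S_def orthogonal_commute span_base)
  ultimately obtain x l where x: "x \<in> S" "norm x = 1" "f x = l *\<^sub>R x"
    using self_adjoint_eigenvector_in_subspace[OF lin sym S _ _ y(1)] by blast
  have "x \<notin> B" using x by (auto simp: S_def orthogonal_def dot_square_norm)
  moreover have "pairwise orthogonal (insert x B)"
    using B(3) x(1) by (auto simp: pairwise_insert S_def orthogonal_commute)
  ultimately show ?case
    using B ev x by (intro exI[of _ "insert x B"]) auto
qed

text \<open>Generic in the entry type, because the same matrix algebra is used over the reals, the
  complex numbers and the rational functions.\<close>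

definition diag_mat :: "('n \<Rightarrow> 'a::zero) \<Rightarrow> 'a ^ 'n ^ 'n::finite" where
  "diag_mat d = (\<chi> i j. if i = j then d i else 0)"

lemma diag_mat_mult: "(diag_mat d ** A) $ i $ j = (d i * A $ i $ j :: 'a::semiring_1)"
proof -
  have "(diag_mat d ** A) $ i $ j = (\<Sum>k\<in>UNIV. if i = k then d i * A $ k $ j else 0)"
    unfolding diag_mat_def matrix_matrix_mult_def vec_lambda_beta by (intro sum.cong) auto
  then show ?thesis by simp
qed

lemma mult_diag_mat: "(A ** diag_mat d) $ i $ j = (A $ i $ j * d j :: 'a::semiring_1)"
proof -
  have "(A ** diag_mat d) $ i $ j = (\<Sum>k\<in>UNIV. if j = k then A $ i $ k * d k else 0)"
    unfolding diag_mat_def matrix_matrix_mult_def vec_lambda_beta by (intro sum.cong) auto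
  then show ?thesis by simp
qed

lemma symmetric_matrix_diagonalization:
  fixes Q :: "real ^ 'n ^ 'n::finite"
  assumes "transpose Q = Q"
  obtains P d where "orthogonal_matrix P" "Q = P ** diag_mat d ** transpose P"
proof -
  have "(Q *v x) \<bullet> y = x \<bullet> (Q *v y)" for x y
    using assms by (metis assms dot_lmul_matrix transpose_matrix_vector)
  from self_adjoint_orthonormal_eigenvectors[OF matrix_vector_mul_linear this order_refl]
  obtain B :: "(real ^ 'n) set" where B: "finite B" "card B = CARD('n)" "pairwise orthogonal B"
    "\<And>b. b \<in> B \<Longrightarrow> norm b = 1" and ev: "\<And>b. b \<in> B \<Longrightarrow> \<exists>l. Q *v b = l *\<^sub>R b"
    by auto
  then obtain u where u: "bij_betw u (UNIV :: 'n set) B"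
    by (metis finite_same_card_bij finite)
  obtain l where l: "\<And>b. b \<in> B \<Longrightarrow> Q *v b = l b *\<^sub>R b"
    using ev by metis
  define P where "P = (\<chi> i j. u j $ i)"
  define d where "d j = l (u j)" for j
  have uB: "u j \<in> B" for j using u by (auto simp: bij_betw_def)
  have col: "column j P = u j" for j
    by (simp add: P_def column_def vec_eq_iff)
  have P: "orthogonal_matrix P"
    unfolding orthogonal_matrix_orthonormal_columns col
    using B(3,4) uB u by (auto simp: pairwise_def bij_betw_def inj_eq)
  have "Q ** P = P ** diag_mat d"
  proof -
    have "(Q ** P) $ i $ j = (P ** diag_mat d) $ i $ j" for i j
    proof -
      have "(Q ** P) $ i $ j = (Q *v u j) $ i"
        by (simp add: matrix_matrix_mult_def matrix_vector_mult_def P_def)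
      also have "\<dots> = l (u j) * u j $ i" by (simp add: l[OF uB])
      finally show ?thesis by (simp add: mult_diag_mat P_def d_def)
    qed
    then show ?thesis by (simp add: vec_eq_iff)
  qed
  then have "Q ** P ** transpose P = P ** diag_mat d ** transpose P" by simp
  then have "Q = P ** diag_mat d ** transpose P"
    using P by (simp add: orthogonal_matrix_def flip: matrix_mul_assoc)
  with P show ?thesis by (rule that)
qed

section \<open>Loop factorisation and small gain\<close>

lemma det_diag_mat: "det (diag_mat d) = (\<Prod>i\<in>UNIV. d i :: 'a::comm_ring_1)"
  by (subst det_diagonal) (auto simp: diag_mat_def)

text \<open>\<open>R\<close> plays the role of the inverse of \<open>P\<close>. Keeping it as a
  separate argument lets the images of \<open>P\<close> and \<open>transpose P\<close> under an
  entrywise embedding be used directly.\<close>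

definition conj_diag :: "'a ^ 'n ^ 'n \<Rightarrow> 'a ^ 'n ^ 'n \<Rightarrow> ('n::finite \<Rightarrow> 'a::comm_ring_1) \<Rightarrow> 'a ^ 'n ^ 'n" where
  "conj_diag P R d = P ** diag_mat d ** R"

lemma conj_diag_nth: "conj_diag P R d $ i $ j = (\<Sum>k\<in>UNIV. P $ i $ k * d k * R $ k $ j)"
  unfolding conj_diag_def by (subst matrix_matrix_mult_def) (simp add: mult_diag_mat)

lemma conj_diag_mult:
  assumes "R ** P = mat 1"
  shows "conj_diag P R a ** conj_diag P R b = conj_diag P R (\<lambda>k. a k * b k)"
proof -
  have "diag_mat a ** diag_mat b = diag_mat (\<lambda>k. a k * b k)"
    by (simp add: vec_eq_iff diag_mat_mult) (simp add: diag_mat_def)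
  moreover have "conj_diag P R a ** conj_diag P R b =
      P ** (diag_mat a ** (R ** P) ** diag_mat b) ** R"
    by (simp add: conj_diag_def matrix_mul_assoc)
  ultimately show ?thesis using assms by (simp add: conj_diag_def)
qed

lemma conj_diag_1:
  assumes "P ** R = mat 1"
  shows "conj_diag P R (\<lambda>_. 1) = mat 1"
proof -
  have "P ** diag_mat (\<lambda>_. 1) = P" by (simp add: vec_eq_iff mult_diag_mat)
  then show ?thesis using assms by (simp add: conj_diag_def)
qed

lemma conj_diag_diff: "conj_diag P R (\<lambda>k. a k - b k) = conj_diag P R a - conj_diag P R b"
  by (simp add: vec_eq_iff conj_diag_nth sum_subtractf[symmetric] algebra_simps)

lemma det_conj_diag:
  assumes "P ** R = mat 1"
  shows "det (conj_diag P R d) = (\<Prod>k\<in>UNIV. d k)"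
proof -
  have "det P * det R = 1" by (metis assms det_I det_mul)
  then show ?thesis by (simp add: conj_diag_def det_mul det_diag_mat mult.commute mult.left_commute)
      (metis mult.assoc mult.left_neutral mult.commute)
qed

lemma matrix_sub_rdistrib: "(A - B) ** C = A ** C - B ** (C :: 'a::comm_ring_1 ^ 'n ^ 'n)"
  by (simp add: vec_eq_iff matrix_matrix_mult_def sum_subtractf left_diff_distrib)

text \<open>Matrices of the form \<open>conj_diag P R\<close> multiply eigenvalue by eigenvalue, so
  the sensitivity factor times the nominal return difference is the nominal loop with eigenvalues
  \<open>c k * h\<close>. Scaling its rows by \<open>(g i - h) / h\<close> gives the loop with
  \<open>g\<close> minus the nominal one, and the nominal terms cancel.\<close>

lemma loop_factorization:
  fixes h :: "'a::field" and P R :: "'a ^ 'n ^ 'n::finite"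
  assumes PR: "P ** R = mat 1" and h: "h \<noteq> 0" and nz: "\<And>k. 1 - c k * h \<noteq> 0"
  shows "mat 1 - diag_mat g ** conj_diag P R c =
    (mat 1 - diag_mat (\<lambda>i. (g i - h) / h) ** conj_diag P R (\<lambda>k. c k * h / (1 - c k * h))) **
    conj_diag P R (\<lambda>k. 1 - c k * h)"
proof -
  have RP: "R ** P = mat 1" using PR matrix_left_right_inverse by blast
  have ch: "conj_diag P R (\<lambda>k. c k * h) $ i $ j = h * conj_diag P R c $ i $ j" for i j
    by (simp add: conj_diag_nth sum_distrib_left algebra_simps)
  define D where "D = diag_mat (\<lambda>i. (g i - h) / h)"
  define S where "S = conj_diag P R (\<lambda>k. c k * h / (1 - c k * h))"
  have "S ** conj_diag P R (\<lambda>k. 1 - c k * h) = conj_diag P R (\<lambda>k. c k * h)"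
    using nz by (simp add: S_def conj_diag_mult[OF RP])
  then have "(mat 1 - D ** S) ** conj_diag P R (\<lambda>k. 1 - c k * h) =
      conj_diag P R (\<lambda>k. 1 - c k * h) - D ** conj_diag P R (\<lambda>k. c k * h)"
    by (simp add: matrix_sub_rdistrib flip: matrix_mul_assoc)
  also have "conj_diag P R (\<lambda>k. 1 - c k * h) = mat 1 - conj_diag P R (\<lambda>k. c k * h)"
    by (simp add: conj_diag_diff conj_diag_1[OF PR])
  also have "mat 1 - conj_diag P R (\<lambda>k. c k * h) - D ** conj_diag P R (\<lambda>k. c k * h) =
      mat 1 - diag_mat g ** conj_diag P R c"
    unfolding vec_eq_iff vector_minus_component D_def diag_mat_mult ch
    using h by (simp add: diff_divide_distrib left_diff_distrib)
  finally show ?thesis by (simp add: D_def S_def conj_diag_diff conj_diag_1[OF PR])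
qed

section \<open>Euclidean gain bounds on complex vectors\<close>

lemma norm_complex_vec:
  fixes v :: "complex ^ 'n::finite"
  shows "(norm v)\<^sup>2 = (norm (\<chi> i. Re (v $ i)))\<^sup>2 + (norm (\<chi> i. Im (v $ i)))\<^sup>2"
  by (simp add: norm_vec_def L2_set_def sum_nonneg cmod_power2 sum.distrib)

lemma norm_orthogonal_matrix_mult:
  fixes P :: "real ^ 'n ^ 'n::finite"
  assumes "orthogonal_matrix P"
  shows "norm (P *v x) = norm x"
  using assms by (metis matrix_of_matrix_vector_mul matrix_vector_mul_linear
      orthogonal_transformation orthogonal_transformation_matrix)

text \<open>A real matrix acts separately on real and imaginary parts, and an orthogonal one
  preserves the norm of each.\<close>

lemma norm_orthogonal_matrix_mult_complex:
  fixes P :: "real ^ 'n ^ 'n::finite"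
  assumes "orthogonal_matrix P"
  shows "norm (map_matrix complex_of_real P *v v) = norm v"
proof -
  have "(\<chi> i. Re ((map_matrix complex_of_real P *v v) $ i)) = P *v (\<chi> i. Re (v $ i))"
    "(\<chi> i. Im ((map_matrix complex_of_real P *v v) $ i)) = P *v (\<chi> i. Im (v $ i))"
    by (simp_all add: vec_eq_iff matrix_vector_mult_def)
  then have "(norm (map_matrix complex_of_real P *v v))\<^sup>2 = (norm v)\<^sup>2"
    by (simp add: norm_complex_vec norm_orthogonal_matrix_mult[OF assms])
  then show ?thesis by simp
qed

lemma diag_mat_mult_vec: "(diag_mat d *v x) $ i = (d i * x $ i :: 'a::semiring_1)"
proof -
  have "(diag_mat d *v x) $ i = (\<Sum>k\<in>UNIV. if i = k then d i * x $ k else 0)"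
    unfolding diag_mat_def matrix_vector_mult_def vec_lambda_beta by (intro sum.cong) auto
  then show ?thesis by simp
qed

lemma norm_diag_mat_mult_le:
  fixes d :: "'n::finite \<Rightarrow> complex"
  assumes "\<And>i. cmod (d i) \<le> K"
  shows "norm (diag_mat d *v v) \<le> K * norm v"
proof -
  have "0 \<le> K" using assms norm_ge_zero order_trans by blast
  have "norm (diag_mat d *v v) \<le> norm (K *\<^sub>R v)"
    using assms \<open>0 \<le> K\<close>
    by (intro norm_le_componentwise_cart) (simp add: diag_mat_mult_vec norm_mult mult_right_mono)
  then show ?thesis using \<open>0 \<le> K\<close> by simp
qed

text \<open>A singular matrix would yield a nonzero \<open>v\<close> with
  \<open>v = ?M *v v\<close>. The orthogonal factors preserve the norm and the diagonal ones scale
  it by at most \<open>a\<close> and \<open>b\<close>, so \<open>?M\<close> is a strict contraction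
  and cannot fix \<open>v\<close>.\<close>

lemma small_gain:
  fixes P :: "real ^ 'n ^ 'n::finite"
  assumes P: "orthogonal_matrix P" and e: "\<And>i. cmod (e i) \<le> b" and T: "\<And>k. cmod (T k) \<le> a"
    and ab: "a * b < 1"
  shows "det (mat 1 - diag_mat e ** conj_diag (map_matrix complex_of_real P)
    (map_matrix complex_of_real (transpose P)) T) \<noteq> 0" (is "det (mat 1 - ?M) \<noteq> 0")
proof
  assume "det (mat 1 - ?M) = 0"
  then obtain v where v: "v \<noteq> 0" "(mat 1 - ?M) *v v = 0"
    by (metis invertible_det_nz invertible_left_inverse matrix_left_invertible_ker)
  have "v = ?M *v v" using v(2) by (simp add: matrix_vector_mult_diff_rdistrib)
  have b: "0 \<le> b" using e norm_ge_zero order_trans by blast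
  have "orthogonal_matrix (transpose P)" using P by simp
  note n = norm_orthogonal_matrix_mult_complex[OF P] norm_orthogonal_matrix_mult_complex[OF this]
  have "norm (?M *v v) \<le> b * norm (conj_diag (map_matrix complex_of_real P)
    (map_matrix complex_of_real (transpose P)) T *v v)"
    unfolding matrix_vector_mul_assoc[symmetric] by (rule norm_diag_mat_mult_le[OF e])
  also have "\<dots> \<le> b * (a * norm v)"
    unfolding conj_diag_def matrix_vector_mul_assoc[symmetric] n(1)
    using norm_diag_mat_mult_le[OF T, where v = "map_matrix complex_of_real (transpose P) *v v"] b
    by (simp add: n(2) mult_left_mono)
  finally have "1 * norm v \<le> (a * b) * norm v"
    using \<open>v = ?M *v v\<close> by (simp add: mult_ac)
  with v(1) ab show False by simp
qed

section \<open>Evaluation of determinants and embedding of constant matrices\<close>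

lemma tf_eval_sum:
  assumes "finite A" "\<And>i. i \<in> A \<Longrightarrow> \<not> tf_pole (f i) z"
  shows "\<not> tf_pole (sum f A) z \<and> tf_eval (sum f A) z = (\<Sum>i\<in>A. tf_eval (f i) z)"
  using assms by (induction A) (auto simp: tf_eval_add)

lemma tf_eval_prod:
  assumes "finite A" "\<And>i. i \<in> A \<Longrightarrow> \<not> tf_pole (f i) z"
  shows "\<not> tf_pole (prod f A) z \<and> tf_eval (prod f A) z = (\<Prod>i\<in>A. tf_eval (f i) z)"
  using assms by (induction A) (auto simp: tf_eval_mult)

lemma tf_eval_det:
  fixes A :: "tf ^ 'n ^ 'n::finite"
  assumes "\<And>i j. \<not> tf_pole (A $ i $ j) z"
  shows "\<not> tf_pole (det A) z \<and> tf_eval (det A) z = det (map_matrix (\<lambda>f. tf_eval f z) A)"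
proof -
  \<comment> \<open>The signs in the Leibniz formula are rewritten as constant transfer functions,
    so that the evaluation rules apply to them.\<close>
  have s: "of_int (sign p) = tf_const (of_int (sign p))" for p :: "'n \<Rightarrow> 'n"
    by (simp add: sign_def)
  have "\<not> tf_pole (of_int (sign p) * (\<Prod>i\<in>UNIV. A $ i $ p i)) z \<and>
    tf_eval (of_int (sign p) * (\<Prod>i\<in>UNIV. A $ i $ p i)) z =
    of_int (sign p) * (\<Prod>i\<in>UNIV. map_matrix (\<lambda>f. tf_eval f z) A $ i $ p i)" for p :: "'n \<Rightarrow> 'n"
    unfolding s using tf_eval_mult[OF tf_eval_const(1)] tf_eval_prod[of UNIV "\<lambda>i. A $ i $ p i" z] assms
    by simp
  then show ?thesis unfolding det_def by (subst tf_eval_sum) (auto simp: tf_eval_sum)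
qed

lemma tf_const_sum: "tf_const (sum f A) = (\<Sum>i\<in>A. tf_const (f i))"
  by (induction A rule: infinite_finite_induct) auto

lemma map_matrix_tf_const_mult:
  "map_matrix tf_const (A ** B) = map_matrix tf_const A ** map_matrix tf_const B"
  by (simp add: vec_eq_iff matrix_matrix_mult_def tf_const_sum)

lemma map_matrix_tf_const_1: "map_matrix tf_const (mat 1) = mat 1"
  by (simp add: vec_eq_iff mat_def)

lemma map_matrix_tf_const_diag:
  "map_matrix tf_const (diag_mat d) = diag_mat (\<lambda>k. tf_const (d k))"
  by (simp add: vec_eq_iff diag_mat_def)

section \<open>Behaviour at infinity and strict bounds\<close>

lemma tf_s_eval [simp]: "\<not> tf_pole tf_s z" "tf_eval tf_s z = z"
  by (simp_all add: tf_s_def)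

lemma tf_s_nonzero [simp]: "tf_s \<noteq> 0"
  by (simp add: tf_s_def)

text \<open>Behaviour at infinity is tested along the positive real axis only. This ray lies in the
  open right half-plane, where the norm bounds hold, and suffices to identify the value of a
  function that is constant there.\<close>

definition tf_tendsto :: "tf \<Rightarrow> complex \<Rightarrow> bool" where
  "tf_tendsto f c \<longleftrightarrow> ((\<lambda>x::real. tf_eval f (of_real x)) \<longlongrightarrow> c) at_top"

lemma tf_tendsto_const: "tf_tendsto (tf_const c) (of_real c)"
  by (simp add: tf_tendsto_def)

lemma tf_tendsto_add:
  assumes "tf_tendsto f a" "tf_tendsto g b" shows "tf_tendsto (f + g) (a + b)"
proof -
  have "eventually (\<lambda>x::real. tf_eval f (of_real x) + tf_eval g (of_real x) = tf_eval (f + g) (of_real x)) at_top"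
    using tf_regular_at_top[of f] tf_regular_at_top[of g]
    by eventually_elim (simp add: tf_eval_add)
  then show ?thesis
    using assms unfolding tf_tendsto_def by (blast intro: Lim_transform_eventually tendsto_add)
qed

lemma tf_tendsto_mult:
  assumes "tf_tendsto f a" "tf_tendsto g b" shows "tf_tendsto (f * g) (a * b)"
proof -
  have "eventually (\<lambda>x::real. tf_eval f (of_real x) * tf_eval g (of_real x) = tf_eval (f * g) (of_real x)) at_top"
    using tf_regular_at_top[of f] tf_regular_at_top[of g]
    by eventually_elim (simp add: tf_eval_mult)
  then show ?thesis
    using assms unfolding tf_tendsto_def by (blast intro: Lim_transform_eventually tendsto_mult)
qed

lemma tf_tendsto_divide:
  assumes "tf_tendsto f a" "tf_tendsto g b" "b \<noteq> 0" shows "tf_tendsto (f / g) (a / b)"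
proof -
  have "eventually (\<lambda>x::real. tf_eval g (of_real x) \<noteq> 0) at_top"
    using assms(2,3) unfolding tf_tendsto_def by (rule tendsto_imp_eventually_ne)
  then have "eventually (\<lambda>x::real. tf_eval f (of_real x) / tf_eval g (of_real x) = tf_eval (f / g) (of_real x)) at_top"
    using tf_regular_at_top[of f] tf_regular_at_top[of g]
    by eventually_elim (simp add: tf_eval_divide)
  then show ?thesis
    using assms unfolding tf_tendsto_def by (blast intro: Lim_transform_eventually tendsto_divide)
qed

text \<open>Covers the generator and, with \<open>a = 1\<close> and \<open>b = 0\<close>, the
  integrator.\<close>

lemma tf_tendsto_inverse_affine:
  assumes "a \<noteq> 0"
  shows "tf_tendsto (1 / (tf_const a * tf_s + tf_const b)) 0"
proof -
  have lin: "tf_eval (tf_const a * tf_s + tf_const b) z = of_real a * z + of_real b"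
    and reg: "\<not> tf_pole (tf_const a * tf_s + tf_const b) z" for z
    by (simp_all add: tf_eval_add tf_eval_mult)
  have "eventually (\<lambda>x::real. x \<noteq> - b / a) at_top"
    using eventually_gt_at_top by (rule eventually_mono) auto
  then have "eventually (\<lambda>x::real. of_real (1 / (a * x + b)) =
      tf_eval (1 / (tf_const a * tf_s + tf_const b)) (complex_of_real x)) at_top"
  proof eventually_elim
    case (elim x)
    then have "a * x + b \<noteq> 0" using assms by (auto simp: field_simps)
    then have "complex_of_real a * of_real x + of_real b \<noteq> 0"
      by (simp flip: of_real_mult of_real_add)
    then show ?case by (simp add: tf_eval_divide lin reg)
  qed
  moreover have "((\<lambda>x. complex_of_real (1 / (a * x + b))) \<longlongrightarrow> of_real 0) at_top"
    by (intro tendsto_of_real) (use assms in real_asymp)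
  ultimately show ?thesis
    unfolding tf_tendsto_def by (auto intro: Lim_transform_eventually)
qed

text \<open>The generator and the integrator are strictly proper and the other blocks are proper, so the
  feedback loop in the denominator vanishes at infinity.\<close>

lemma local_agent_tendsto_0:
  assumes "admissible_area a" "tf_proper C"
  shows "tf_tendsto (local_agent a C) 0"
proof -
  obtain c g u where lim: "tf_tendsto C c" "tf_tendsto (governor a) g" "tf_tendsto (turbine a) u"
    using assms unfolding admissible_area_def tf_tendsto_def by (metis tf_proper_limit)
  have F: "tf_tendsto (generator a) 0"
    using assms unfolding generator_def admissible_area_def by (intro tf_tendsto_inverse_affine) auto
  have s: "tf_tendsto (1 / tf_s) 0"
    using tf_tendsto_inverse_affine[of 1 0] by simp
  have R: "tf_tendsto (1 / tf_const (droop a)) (of_real (1 / droop a))"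
    using tf_tendsto_const[of "1 / droop a"] by (simp add: tf_const_divide)
  have one: "tf_tendsto 1 1"
    using tf_tendsto_const[of 1] by simp
  have "tf_tendsto (local_agent a C) (0 * (((1 + c * g * u) * 0) /
      (1 + (of_real (bias a) * c + of_real (1 / droop a)) * g * u * 0)))"
    unfolding local_agent_def
    by (intro tf_tendsto_mult tf_tendsto_divide tf_tendsto_add lim F s R one tf_tendsto_const) simp
  then show ?thesis by simp
qed

text \<open>The norm bound makes \<open>f\<close> holomorphic on the half-plane, which is open and
  convex, hence connected; attaining \<open>K\<close> at \<open>z\<close> is then an interior
  maximum of the modulus.\<close>

lemma hinf_norm_attained_imp_constant:
  assumes "hinf_norm f \<le> ereal K" "0 < Re z" "cmod (tf_eval f z) = K" "0 < Re w"
  shows "tf_eval f w = tf_eval f z"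
proof -
  let ?S = "{z. 0 < Re z}"
  have b: "\<not> tf_pole f u \<and> cmod (tf_eval f u) \<le> K" if "u \<in> ?S" for u
    using assms(1) that by (simp add: hinf_norm_le_iff_open)
  have "tf_eval f constant_on ?S"
  proof (rule maximum_modulus_principle)
    show "tf_eval f holomorphic_on ?S" using b by (blast intro: tf_eval_holomorphic)
    show "open ?S" by (rule open_halfspace_Re_gt)
    show "connected ?S" by (intro convex_connected convex_halfspace_Re_gt)
    show "open ?S" by (rule open_halfspace_Re_gt)
    show "z \<in> ?S" using assms by simp
    show "cmod (tf_eval f u) \<le> cmod (tf_eval f z)" if "u \<in> ?S" for u
      using b[OF that] assms by simp
  qed simp
  then show ?thesis using assms by (auto simp: constant_on_def)
qed

text \<open>Since \<open>H\<close> vanishes at infinity and \<open>\<bar>H\<bar> \<ge> (1 - \<xi>) \<bar>H\<^sub>n\<bar>\<close>, so does the complementary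
  sensitivity; by the maximum modulus principle its bound is then not attained in the open
  half-plane.\<close>

lemma comp_sens_strict_bound:
  assumes Hn: "Hn \<noteq> 0" and \<xi>: "0 < \<xi>" "\<xi> < 1" and H: "tf_tendsto H 0"
    and match: "hinf_norm (rel_error Hn H) \<le> ereal \<xi>"
    and sens: "hinf_norm (comp_sens Hn l) \<le> ereal K" and K: "0 < K" and z: "0 < Re z"
    and nz: "1 - tf_const l * Hn \<noteq> 0"
  shows "cmod (tf_eval (comp_sens Hn l) z) < K"
proof (rule ccontr)
  assume "\<not> cmod (tf_eval (comp_sens Hn l) z) < K"
  with hinf_norm_leD[OF sens, of z] z have eq: "cmod (tf_eval (comp_sens Hn l) z) = K" by simp
  have Hn_eq: "Hn * (1 + rel_error Hn H) = H" using Hn by (simp add: rel_error_def distrib_left)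
  have "eventually (\<lambda>x::real. norm (tf_eval Hn (of_real x)) \<le> norm (tf_eval H (of_real x)) * (1 / (1 - \<xi>))) at_top"
    using tf_regular_at_top[of Hn] eventually_gt_at_top[of 0]
  proof eventually_elim
    case (elim x)
    let ?e = "tf_eval (rel_error Hn H) (of_real x)"
    have e: "\<not> tf_pole (rel_error Hn H) (of_real x)" "cmod ?e \<le> \<xi>"
      using hinf_norm_leD[OF match, of "of_real x"] elim by auto
    then have "tf_eval H (of_real x) = tf_eval Hn (of_real x) * (1 + ?e)"
      using elim by (subst Hn_eq[symmetric]) (simp add: tf_eval_mult tf_eval_add)
    moreover have "1 - \<xi> \<le> cmod (1 + ?e)"
      using e(2) norm_triangle_ineq2[of 1 "- ?e"] by simp
    ultimately show ?case
      using \<xi> by (simp add: norm_mult pos_le_divide_eq mult_left_mono)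
  qed
  then have Hn0: "tf_tendsto Hn 0"
    unfolding tf_tendsto_def
  proof (rule Lim_null_comparison)
    show "((\<lambda>x. norm (tf_eval H (of_real x)) * (1 / (1 - \<xi>))) \<longlongrightarrow> 0) at_top"
      using H unfolding tf_tendsto_def by (intro tendsto_mult_left_zero tendsto_norm_zero)
  qed
  \<comment> \<open>The difference \<open>1 - tf_const l * Hn\<close> is written as a sum to fit the
    limit rules. Its limit is 1, so the division rule applies to the complementary
    sensitivity.\<close>
  have "tf_tendsto (1 + tf_const (- l) * Hn) (1 + of_real (- l) * 0)"
    using tf_tendsto_const[of 1] by (intro tf_tendsto_add tf_tendsto_mult tf_tendsto_const Hn0) simp
  then have "tf_tendsto (comp_sens Hn l) ((of_real l * 0) / (1 + of_real (- l) * 0))"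
    unfolding comp_sens_def by (intro tf_tendsto_divide tf_tendsto_mult tf_tendsto_const Hn0) simp_all
  then have "((\<lambda>x::real. tf_eval (comp_sens Hn l) (of_real x)) \<longlongrightarrow> 0) at_top"
    by (simp add: tf_tendsto_def)
  \<comment> \<open>Attainment at \<open>z\<close> makes the function constant on the half-plane, so
    this constant must equal the limit 0, contradicting \<open>0 < K\<close>.\<close>
  moreover have "eventually (\<lambda>x::real. tf_eval (comp_sens Hn l) (of_real x) = tf_eval (comp_sens Hn l) z) at_top"
    using eventually_gt_at_top[of 0]
    by eventually_elim (use hinf_norm_attained_imp_constant[OF sens z eq] in simp)
  ultimately have "((\<lambda>x::real. tf_eval (comp_sens Hn l) z) \<longlongrightarrow> 0) at_top"
    by (rule Lim_transform_eventually)
  then have "tf_eval (comp_sens Hn l) z = 0" by (simp add: tendsto_const_iff)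
  then show False using eq K by simp
qed

section \<open>Zeros of the characteristic function\<close>

text \<open>Since \<open>1 - l Hn = (1 / Hn - l) Hn\<close>, a zero could only come from
  \<open>Hn\<close>; but where \<open>Hn\<close> vanishes the left-hand side has the value
  1.\<close>

lemma nominal_loop_no_zero:
  assumes "Hn \<noteq> 0" "\<not> tf_zero (1 / Hn - tf_const l) z"
  shows "\<not> tf_zero (1 - tf_const l * Hn) z"
proof
  assume *: "tf_zero (1 - tf_const l * Hn) z"
  have "1 - tf_const l * Hn = (1 / Hn - tf_const l) * Hn" using assms(1) by (simp add: field_simps)
  then have "tf_zero Hn z" using tf_zero_mult[of "1 / Hn - tf_const l" Hn z] * assms(2) by auto
  then have "tf_eval (1 - tf_const l * Hn) z = 1"
    by (simp add: tf_zero_iff tf_eval_mult tf_eval_diff)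
  then show False using * by (simp add: tf_zero_iff)
qed

lemma diag_tf_eq: "diag_tf H = diag_mat H"
  by (simp add: diag_tf_def diag_mat_def)

lemma tf_zero_0 [simp]: "tf_zero 0 z"
  by (simp add: tf_zero_iff)

text \<open>The factorisation is carried out in the field of rational functions, where poles of the
  \<open>H i\<close> or of \<open>Hn\<close> at \<open>z\<close> do no harm. Only the factor built
  from relative errors and complementary sensitivities is evaluated at \<open>z\<close>, and its
  entries are regular there, so \<open>small_gain\<close> applies to its values.\<close>

lemma char_fun_zero_gains:
  fixes P :: "real ^ 'n ^ 'n::finite"
  assumes P: "orthogonal_matrix P" and Q: "Q = P ** diag_mat d ** transpose P"
    and Hn: "Hn \<noteq> 0" and nz: "\<And>k. \<not> tf_zero (1 - tf_const (d k) * Hn) z"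
    and e: "\<And>i. \<not> tf_pole (rel_error Hn (H i)) z \<and> cmod (tf_eval (rel_error Hn (H i)) z) \<le> b"
    and T: "\<And>k. \<not> tf_pole (comp_sens Hn (d k)) z \<and> cmod (tf_eval (comp_sens Hn (d k)) z) \<le> a"
    and zero: "tf_zero (char_fun H Q) z"
  shows "1 \<le> a * b"
proof (rule ccontr)
  assume ab: "\<not> 1 \<le> a * b"
  define Pf Rf where "Pf = map_matrix tf_const P" and "Rf = map_matrix tf_const (transpose P)"
  define E where "E = diag_mat (\<lambda>i. rel_error Hn (H i))"
  define S where "S = conj_diag Pf Rf (\<lambda>k. comp_sens Hn (d k))"
  have PR: "Pf ** Rf = mat 1"
    using P by (simp add: Pf_def Rf_def orthogonal_matrix_def map_matrix_tf_const_1 flip: map_matrix_tf_const_mult)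
  \<comment> \<open>The zero function counts as having a zero everywhere, so having no zero at
    \<open>z\<close> implies being a nonzero element of the field.\<close>
  have nz0: "1 - tf_const (d k) * Hn \<noteq> 0" for k using nz[of k] by auto
  have "map_matrix tf_const Q = conj_diag Pf Rf (\<lambda>k. tf_const (d k))"
    by (simp add: Q conj_diag_def map_matrix_tf_const_mult map_matrix_tf_const_diag Pf_def Rf_def)
  then have "mat 1 - diag_tf H ** map_matrix tf_const Q =
      (mat 1 - E ** S) ** conj_diag Pf Rf (\<lambda>k. 1 - tf_const (d k) * Hn)"
    using loop_factorization[OF PR Hn nz0, of H]
    by (simp add: diag_tf_eq E_def S_def rel_error_def comp_sens_def)
  then have "char_fun H Q = det (mat 1 - E ** S) * (\<Prod>k\<in>UNIV. 1 - tf_const (d k) * Hn)"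
    by (simp add: char_fun_def det_mul det_conj_diag[OF PR])
  then have z: "tf_zero (det (mat 1 - E ** S)) z"
    using zero nz tf_zero_mult tf_zero_prod[of UNIV "\<lambda>k. 1 - tf_const (d k) * Hn" z] by fastforce
  have S: "\<not> tf_pole (S $ i $ j) z \<and> tf_eval (S $ i $ j) z =
      conj_diag (map_matrix complex_of_real P) (map_matrix complex_of_real (transpose P))
        (\<lambda>k. tf_eval (comp_sens Hn (d k)) z) $ i $ j" for i j
    unfolding S_def conj_diag_nth Pf_def Rf_def using T
    by (subst tf_eval_sum) (auto simp: tf_eval_mult tf_eval_sum)
  let ?M = "mat 1 - diag_mat (\<lambda>i. tf_eval (rel_error Hn (H i)) z) **
      conj_diag (map_matrix complex_of_real P) (map_matrix complex_of_real (transpose P))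
        (\<lambda>k. tf_eval (comp_sens Hn (d k)) z)"
  have M: "\<not> tf_pole ((mat 1 - E ** S) $ i $ j) z \<and> tf_eval ((mat 1 - E ** S) $ i $ j) z = ?M $ i $ j" for i j
  proof -
    have "(mat 1 - E ** S) $ i $ j = (if i = j then 1 else 0) - rel_error Hn (H i) * S $ i $ j"
      by (simp add: E_def diag_mat_mult mat_def)
    moreover have "?M $ i $ j = (if i = j then 1 else 0) - tf_eval (rel_error Hn (H i)) z *
        conj_diag (map_matrix complex_of_real P) (map_matrix complex_of_real (transpose P))
        (\<lambda>k. tf_eval (comp_sens Hn (d k)) z) $ i $ j"
      by (simp add: diag_mat_mult mat_def)
    moreover have "\<not> tf_pole (rel_error Hn (H i) * S $ i $ j) z \<and>
      tf_eval (rel_error Hn (H i) * S $ i $ j) z = tf_eval (rel_error Hn (H i)) z * tf_eval (S $ i $ j) z"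
      using e S by (simp add: tf_eval_mult)
    ultimately show ?thesis using S[of i j] by (simp add: tf_eval_diff tf_eval_uminus)
  qed
  then have "map_matrix (\<lambda>f. tf_eval f z) (mat 1 - E ** S) = ?M"
    by (simp add: vec_eq_iff)
  then have "det ?M = 0"
    using z tf_eval_det[of "mat 1 - E ** S" z] M by (simp add: tf_zero_iff)
  moreover have "det ?M \<noteq> 0"
    using e T ab by (intro small_gain[OF P, of _ b _ a]) auto
  ultimately show False by simp
qed

section \<open>Spectrum of the tie-line matrix\<close>

text \<open>The tie-line matrix is a weighted graph Laplacian, whose quadratic form is half the sum
  of \<open>w i j * (v $ i - v $ j)\<^sup>2\<close> over all ordered pairs.\<close>

lemma tie_line_matrix_negative_semidefinite:
  fixes t :: "'n::finite \<Rightarrow> 'n \<Rightarrow> real"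
  assumes t: "\<And>i j. i \<noteq> j \<Longrightarrow> t i j = t j i \<and> 0 \<le> t i j"
  shows "v \<bullet> (- tie_line_matrix t *v v) \<le> 0"
proof -
  \<comment> \<open>The diagonal values \<open>t i i\<close> are unconstrained; setting them to 0
    allows sums over all indices.\<close>
  define w where "w i j = (if i = j then 0 else t i j)" for i j
  have w: "w i j = w j i" "0 \<le> w i j" for i j using t by (auto simp: w_def)
  have row: "(\<Sum>k\<in>UNIV - {i}. t i k) = (\<Sum>k\<in>UNIV. w i k)" for i
    by (rule sum.mono_neutral_cong_left) (auto simp: w_def)
  have nth: "(tie_line_matrix t *v v) $ i = (\<Sum>j\<in>UNIV. w i j * (v $ i - v $ j))" for i
  proof -
    have "(tie_line_matrix t *v v) $ i =
        (\<Sum>j\<in>UNIV. (if i = j then (\<Sum>k\<in>UNIV. w i k) * v $ i else 0) - w i j * v $ j)"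
      unfolding tie_line_matrix_def matrix_vector_mult_def vec_lambda_beta row
      by (intro sum.cong) (auto simp: w_def)
    then show ?thesis
      by (simp add: sum_subtractf right_diff_distrib sum_distrib_right)
  qed
  define A where "A = (\<Sum>i\<in>UNIV. \<Sum>j\<in>UNIV. w i j * (v $ i - v $ j) * v $ i)"
  \<comment> \<open>Exchanging the summation indices and using symmetry of \<open>w\<close> gives a
    second form of \<open>A\<close>; adding the two completes the square.\<close>
  have "A = (\<Sum>i\<in>UNIV. \<Sum>j\<in>UNIV. w i j * (v $ j - v $ i) * v $ j)"
    unfolding A_def by (subst sum.swap) (simp add: w(1))
  then have "A + A = (\<Sum>i\<in>UNIV. \<Sum>j\<in>UNIV. w i j * (v $ i - v $ j)\<^sup>2)"
    by (subst (1) A_def) (simp add: sum.distrib[symmetric] power2_eq_square algebra_simps)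
  also have "\<dots> \<ge> 0" by (intro sum_nonneg mult_nonneg_nonneg w) auto
  finally have "0 \<le> A" by simp
  moreover have "v \<bullet> (tie_line_matrix t *v v) = A"
    by (simp add: inner_vec_def nth A_def sum_distrib_left mult_ac)
  moreover have "- tie_line_matrix t *v v = - (tie_line_matrix t *v v)"
    by (simp add: vec_eq_iff matrix_vector_mult_def sum_negf)
  ultimately show ?thesis by simp
qed

text \<open>The columns of \<open>P\<close> are eigenvectors with eigenvalues \<open>d k\<close>,
  and an eigenvector for \<open>l\<close>, written in the coordinates
  \<open>transpose P *v v\<close>, has a nonzero coordinate that forces \<open>l = d k\<close>. The
  second claim evaluates the quadratic form at a column, which has norm 1.\<close>

lemma diagonalization_negative_eigenvalues:
  fixes Q :: "real ^ 'n ^ 'n::finite"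
  assumes P: "orthogonal_matrix P" and Q: "Q = P ** diag_mat d ** transpose P"
  shows "negative_eigenvalues Q = {l \<in> range d. l < 0}"
    and "(\<And>v. v \<bullet> (Q *v v) \<le> 0) \<Longrightarrow> d k \<le> 0"
proof -
  have PP: "transpose P ** P = mat 1" using P by (simp add: orthogonal_matrix_def)
  have PQ: "transpose P *v (Q *v v) = diag_mat d *v (transpose P *v v)" for v
    by (simp only: Q matrix_vector_mul_assoc matrix_mul_assoc PP matrix_mul_lid)
  have QP: "Q ** P = P ** diag_mat d"
    unfolding Q by (simp add: PP flip: matrix_mul_assoc)
  have ev: "Q *v (P *v axis k 1) = d k *s (P *v axis k 1)" for k
  proof -
    have "diag_mat d *v axis k 1 = d k *s axis k (1::real)"
      by (simp add: diag_mat_mult_vec vec_eq_iff axis_def)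
    then have "P *v (diag_mat d *v axis k 1) = d k *s (P *v axis k 1)"
      by (simp add: vector_scalar_commute)
    then show ?thesis by (simp add: matrix_vector_mul_assoc QP)
  qed
  note n = norm_orthogonal_matrix_mult[OF P]
  have nz: "P *v axis k 1 \<noteq> 0" for k using n[of "axis k 1"] by (auto simp: norm_axis_1)
  have "l \<in> range d" if v: "v \<noteq> 0" "Q *v v = l *s v" for v l
  proof -
    define x where "x = transpose P *v v"
    have "P ** transpose P = mat 1" using P by (simp add: orthogonal_matrix_def)
    then have "P *v x = v"
      by (simp only: x_def matrix_vector_mul_assoc matrix_vector_mul_lid)
    then have "x \<noteq> 0" using v(1) by auto
    then obtain k where k: "x $ k \<noteq> 0" by (auto simp: vec_eq_iff)
    have "diag_mat d *v x = l *s x"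
      using PQ[of v] unfolding v(2) x_def by (simp add: vector_scalar_commute)
    then have "d k * x $ k = l * x $ k" by (simp add: diag_mat_mult_vec vec_eq_iff)
    then show ?thesis using k by auto
  qed
  then show "negative_eigenvalues Q = {l \<in> range d. l < 0}"
    using ev nz unfolding negative_eigenvalues_def by blast
  assume "\<And>v. v \<bullet> (Q *v v) \<le> 0"
  from this[of "P *v axis k 1"] have "d k * (norm (P *v axis k 1))\<^sup>2 \<le> 0"
    by (simp add: ev dot_square_norm[symmetric] scalar_mult_eq_scaleR)
  then show "d k \<le> 0" by (simp add: n norm_axis_1)
qed

section \<open>Constant transfer functions and strict norm bounds\<close>

lemma tf_proper_const [simp]: "tf_proper (tf_const c)"
  by (simp add: tf_proper_def tf_const_def)

lemma tf_proper_0_1 [simp]: "tf_proper 0" "tf_proper 1" "tf_proper (- 1)"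
  using tf_proper_const[of 0] tf_proper_const[of 1] tf_proper_const[of "- 1"] by simp_all

lemma comp_sens_const:
  assumes "l * c \<noteq> 1"
  shows "comp_sens (tf_const c) l = tf_const (l * c / (1 - l * c))"
  by (simp add: comp_sens_def tf_const_divide)

lemma tf_zero_const: "tf_zero (tf_const c) z \<longleftrightarrow> c = 0"
  by (simp add: tf_zero_iff)

lemma stability_cond_const:
  assumes "\<And>l. l \<in> negative_eigenvalues Q \<Longrightarrow> 1 / c \<noteq> l"
  shows "stability_cond Q (tf_const c)"
proof -
  have "1 / tf_const c - tf_const l = tf_const (1 / c - l)" for l
    by (simp add: tf_const_divide)
  then show ?thesis using assms unfolding stability_cond_def by (metis (no_types) right_minus_eq tf_zero_const)
qed

text \<open>A real number strictly between the norm and \<open>K\<close> reduces this to the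
  non-strict bound, which also holds on the imaginary axis.\<close>

lemma hinf_norm_lessD:
  assumes "hinf_norm f < ereal K" "0 \<le> Re z"
  shows "cmod (tf_eval f z) < K"
proof -
  obtain r where "hinf_norm f < ereal r" "ereal r < ereal K"
    using ereal_dense2[OF assms(1)] by auto
  then show ?thesis using hinf_norm_leD[OF less_imp_le assms(2), of f r] by simp
qed

text \<open>The non-strict hypotheses only bound the product of the two gains by 1, so a zero is not
  excluded outright but forces equality in both bounds. In the open half-plane this equality
  contradicts \<open>comp_sens_strict_bound\<close>; on the imaginary axis it remains as a
  restriction on possible zeros.\<close>

lemma
  fixes Q :: "real ^ 'n ^ 'n::finite"
  assumes sym: "transpose Q = Q" and nsd: "\<And>v. v \<bullet> (Q *v v) \<le> 0"
    and H: "\<And>i. tf_tendsto (H i) 0"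
    and Hn: "Hn \<noteq> 0" and \<xi>: "0 < \<xi>" "\<xi> < 1"
    and stab: "stability_cond Q Hn" and rob: "robust_stability_cond Q Hn \<xi>"
    and match: "model_matching_cond H Hn \<xi>"
  shows nominal_model_marginal: "lfc_marginally_stable H Q"
    and nominal_model_boundary_zero: "\<And>z. z \<in> closed_rhp \<Longrightarrow> tf_zero (char_fun H Q) z \<Longrightarrow>
       (\<exists>l\<in>negative_eigenvalues Q. cmod (tf_eval (comp_sens Hn l) z) = 1 / \<xi>) \<and>
       (\<exists>i. cmod (tf_eval (rel_error Hn (H i)) z) = \<xi>)"
proof -
  obtain P d where P: "orthogonal_matrix P" and Q: "Q = P ** diag_mat d ** transpose P"
    using symmetric_matrix_diagonalization[OF sym] .
  note neg = diagonalization_negative_eigenvalues[OF P Q]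
  \<comment> \<open>Conditions (i) and (ii) speak of negative eigenvalues only. For
    \<open>d k = 0\<close> the nominal factor is the constant 1 and the complementary sensitivity is
    0, so the bounds below hold for every \<open>k\<close>.\<close>
  have d: "d k = 0 \<or> d k \<in> negative_eigenvalues Q" for k
    using neg(2)[OF nsd, of k] by (auto simp: neg(1))
  have nz: "\<not> tf_zero (1 - tf_const (d k) * Hn) z" if "z \<in> closed_rhp" for k z
    using d[of k] stab that nominal_loop_no_zero[OF Hn, of "d k" z]
    by (auto simp: stability_cond_def tf_zero_iff)
  have T: "\<not> tf_pole (comp_sens Hn (d k)) z \<and> cmod (tf_eval (comp_sens Hn (d k)) z) \<le> 1 / \<xi>"
    if "z \<in> closed_rhp" for k z
  proof (cases "d k = 0")
    case True
    then show ?thesis using \<xi> by (simp add: comp_sens_def)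
  next
    case False
    with d[of k] rob that show ?thesis
      by (intro hinf_norm_leD) (auto simp: robust_stability_cond_def closed_rhp_def)
  qed
  have e: "\<not> tf_pole (rel_error Hn (H i)) z \<and> cmod (tf_eval (rel_error Hn (H i)) z) \<le> \<xi>"
    if "z \<in> closed_rhp" for i z
    using match that by (intro hinf_norm_leD) (auto simp: model_matching_cond_def closed_rhp_def)
  show boundary: "(\<exists>l\<in>negative_eigenvalues Q. cmod (tf_eval (comp_sens Hn l) z) = 1 / \<xi>) \<and>
      (\<exists>i. cmod (tf_eval (rel_error Hn (H i)) z) = \<xi>)"
    if z: "z \<in> closed_rhp" and zero: "tf_zero (char_fun H Q) z" for z
  proof
    \<comment> \<open>The gain lemma is applied with the actual maximal sensitivity at
      \<open>z\<close> in place of \<open>1 / \<xi>\<close>, which shows that this maximum reaches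
      \<open>1 / \<xi>\<close>. The same is done below for the relative errors.\<close>
    define a where "a = (MAX k. cmod (tf_eval (comp_sens Hn (d k)) z))"
    have "1 \<le> a * \<xi>"
      using T[OF z] e[OF z] by (intro char_fun_zero_gains[OF P Q Hn nz[OF z] _ _ zero]) (auto simp: a_def)
    then have "1 / \<xi> \<le> a" using \<xi> by (simp add: field_simps)
    moreover have "a \<in> range (\<lambda>k. cmod (tf_eval (comp_sens Hn (d k)) z))"
      unfolding a_def by (rule Max_in) auto
    ultimately obtain k where k: "1 / \<xi> \<le> cmod (tf_eval (comp_sens Hn (d k)) z)" by auto
    \<comment> \<open>The maximising index cannot belong to the eigenvalue 0, where the sensitivity
      is 0.\<close>
    with \<xi> have "d k \<noteq> 0" by (auto simp: comp_sens_def field_simps)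
    with d[of k] k T[OF z, of k]
    show "\<exists>l\<in>negative_eigenvalues Q. cmod (tf_eval (comp_sens Hn l) z) = 1 / \<xi>"
      by (intro bexI[of _ "d k"]) auto
    define b where "b = (MAX i. cmod (tf_eval (rel_error Hn (H i)) z))"
    have "1 \<le> (1 / \<xi>) * b"
      using T[OF z] e[OF z] by (intro char_fun_zero_gains[OF P Q Hn nz[OF z] _ _ zero]) (auto simp: b_def)
    then have "\<xi> \<le> b" using \<xi> by (simp add: field_simps)
    moreover have "b \<in> range (\<lambda>i. cmod (tf_eval (rel_error Hn (H i)) z))"
      unfolding b_def by (rule Max_in) auto
    ultimately obtain i where "\<xi> \<le> cmod (tf_eval (rel_error Hn (H i)) z)" by auto
    with e[OF z, of i] show "\<exists>i. cmod (tf_eval (rel_error Hn (H i)) z) = \<xi>"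
      by (intro exI[of _ i]) auto
  qed
  show "lfc_marginally_stable H Q"
    unfolding lfc_marginally_stable_def
  proof (intro allI impI notI)
    fix z assume z: "0 < Re z" and zero: "tf_zero (char_fun H Q) z"
    then have zc: "z \<in> closed_rhp" by (simp add: closed_rhp_def)
    from boundary[OF this zero] obtain l where l: "l \<in> negative_eigenvalues Q"
      "cmod (tf_eval (comp_sens Hn l) z) = 1 / \<xi>" by blast
    have "\<not> tf_zero (1 - tf_const l * Hn) z"
      using stab zc l(1) by (intro nominal_loop_no_zero[OF Hn]) (auto simp: stability_cond_def)
    then have "1 - tf_const l * Hn \<noteq> 0" by auto
    \<comment> \<open>Any single area will do for the comparison at infinity, hence the instance
      \<open>undefined\<close>.\<close>
    then have "cmod (tf_eval (comp_sens Hn l) z) < 1 / \<xi>"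
      using match rob l(1) \<xi> z unfolding model_matching_cond_def robust_stability_cond_def
      by (intro comp_sens_strict_bound[OF Hn \<xi> H[of undefined]]) auto
    with l(2) show False by simp
  qed
qed

section \<open>Counterexamples and the trade-off\<close>

text \<open>With zero agents the characteristic function is 1. For the nominal model 1 the
  sensitivities \<open>l / (1 - l)\<close> have modulus below 1, while the relative error is the
  constant -1, which exceeds the radius \<open>1 / 2\<close> in modulus.\<close>

lemma mismatch_not_necessary:
  fixes Q :: "real ^ 'n ^ 'n::finite"
  shows "\<exists>(area :: 'n \<Rightarrow> lfc_area) (C :: 'n \<Rightarrow> tf) (H :: 'n \<Rightarrow> tf) (Hn :: tf) (\<xi> :: real).
        (\<forall>i. admissible_area (area i) \<and> positive_params (area i) \<and> tf_proper (C i) \<and>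
             H i = local_agent (area i) (C i)) \<and>
        Hn \<noteq> 0 \<and> 0 < \<xi> \<and> \<xi> < 1 \<and>
        stability_cond Q Hn \<and> robust_stability_cond Q Hn \<xi> \<and>
        (\<exists>i. \<not> hinf_norm (rel_error Hn (H i)) \<le> ereal \<xi>) \<and>
        lfc_stable H Q"
proof -
  \<comment> \<open>The controller \<open>- 1\<close> cancels the numerator of the local agent, so that \<open>H = 0\<close>.\<close>
  define a :: lfc_area where "a = \<lparr>inertia = 1, damping = 1, droop = 1, bias = 1, governor = 1, turbine = 1\<rparr>"
  have a: "admissible_area a" "positive_params a" "local_agent a (- 1) = 0"
    by (simp_all add: a_def admissible_area_def positive_params_def local_agent_def)
  have stab: "stability_cond Q (tf_const 1)"
    by (rule stability_cond_const) (auto simp: negative_eigenvalues_def)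
  have rob: "robust_stability_cond Q (tf_const 1) (1 / 2)"
    unfolding robust_stability_cond_def
  proof
    fix l assume "l \<in> negative_eigenvalues Q"
    then have "l < 0" by (simp add: negative_eigenvalues_def)
    then have "\<bar>l * 1 / (1 - l * 1)\<bar> \<le> 1 / (1 / 2)" by (simp add: abs_if field_simps)
    then show "hinf_norm (comp_sens (tf_const 1) l) \<le> ereal (1 / (1 / 2))"
      using \<open>l < 0\<close> unfolding hinf_norm_const[symmetric] by (subst comp_sens_const) auto
  qed
  have "rel_error (tf_const 1) 0 = tf_const (- 1)" by (simp add: rel_error_def)
  then have "\<not> hinf_norm (rel_error (tf_const 1) 0) \<le> ereal (1 / 2)"
    by (simp only: hinf_norm_const)
  moreover have "mat 1 - diag_tf (\<lambda>_. 0) ** map_matrix tf_const Q = mat 1"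
    by (simp add: vec_eq_iff diag_tf_eq diag_mat_mult)
  then have "lfc_stable (\<lambda>_. 0) Q"
    by (simp add: lfc_stable_def char_fun_def tf_zero_iff)
  ultimately show ?thesis using a stab rob
    by (intro exI[of _ "\<lambda>_. a"] exI[of _ "\<lambda>_. - 1"] exI[of _ "\<lambda>_. 0"] exI[of _ "tf_const 1"]
        exI[of _ "1 / 2"]) auto
qed

text \<open>All areas share one agent \<open>h\<close>, and the nominal model is \<open>h\<close>
  divided by \<open>1 + \<xi>'\<close>, so that the relative error is exactly the constant
  \<open>\<xi>'\<close>.\<close>

lemma matching_radius_strict:
  fixes \<xi> \<xi>' :: real
  assumes "0 < \<xi>" "\<xi> < \<xi>'"
  shows "\<exists>(area :: 'n::finite \<Rightarrow> lfc_area) (C :: 'n \<Rightarrow> tf) (H :: 'n \<Rightarrow> tf) (Hn :: tf).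
           (\<forall>i. admissible_area (area i) \<and> positive_params (area i) \<and> tf_proper (C i) \<and>
                H i = local_agent (area i) (C i)) \<and>
           Hn \<noteq> 0 \<and> model_matching_cond H Hn \<xi>' \<and> \<not> model_matching_cond H Hn \<xi>"
proof -
  \<comment> \<open>With vanishing governor and turbine the agent is
    \<open>1 / (s * (s + 1))\<close>, in particular nonzero.\<close>
  define a :: lfc_area where "a = \<lparr>inertia = 1, damping = 1, droop = 1, bias = 1, governor = 0, turbine = 0\<rparr>"
  define h where "h = local_agent a 0"
  have "tf_s + 1 \<noteq> 0"
    using tf_eval_add[of tf_s 0 1] by auto
  then have h: "h \<noteq> 0"
    by (simp add: h_def a_def local_agent_def generator_def)
  have "rel_error (h / tf_const (1 + \<xi>')) h = tf_const (1 + \<xi>') - 1"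
    using h assms by (simp add: rel_error_def field_simps del: tf_const_hom)
  then have e: "rel_error (h / tf_const (1 + \<xi>')) h = tf_const \<xi>'" by simp
  have "h / tf_const (1 + \<xi>') \<noteq> 0" using h assms by (simp del: tf_const_hom)
  moreover have "admissible_area a" "positive_params a"
    by (simp_all add: a_def admissible_area_def positive_params_def)
  ultimately show ?thesis using assms
    by (intro exI[of _ "\<lambda>_. a"] exI[of _ "\<lambda>_. 0"] exI[of _ "\<lambda>_. h"] exI[of _ "h / tf_const (1 + \<xi>')"])
      (simp add: h_def[symmetric] model_matching_cond_def e hinf_norm_const del: tf_const_hom)
qed

lemma robustness_radius_strict:
  fixes \<xi> \<xi>' :: real and Q :: "real ^ 'n ^ 'n::finite"
  assumes \<xi>: "0 < \<xi>" "\<xi> < \<xi>'" and ne: "negative_eigenvalues Q \<noteq> {}"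
    and fin: "finite (negative_eigenvalues Q)"
  shows "\<exists>Hn. Hn \<noteq> 0 \<and> stability_cond Q Hn \<and>
              robust_stability_cond Q Hn \<xi> \<and> \<not> robust_stability_cond Q Hn \<xi>'"
proof -
  define m where "m = - Min (negative_eigenvalues Q)"
  have m: "- m \<in> negative_eigenvalues Q" "\<And>l. l \<in> negative_eigenvalues Q \<Longrightarrow> - m \<le> l \<and> l < 0"
    using Min_in[OF fin ne] Min_le[OF fin] by (auto simp: m_def negative_eigenvalues_def)
  then have "0 < m" by force
  \<comment> \<open>With \<open>Hn = - b\<close> the gain at \<open>l\<close> is \<open>u / (1 - u)\<close> for \<open>u = - l * b\<close>; it increases with \<open>u\<close> and
    equals \<open>1 / \<xi>\<close> for \<open>u = 1 / (1 + \<xi>)\<close>, which is attained at the smallest eigenvalue.\<close>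
  define b where "b = 1 / ((1 + \<xi>) * m)"
  have b: "0 < b" "m * b = 1 / (1 + \<xi>)" using \<open>0 < m\<close> \<xi> by (auto simp: b_def)
  have lb: "0 < - l * b" "- l * b \<le> 1 / (1 + \<xi>)" "- l * b < 1" if "l \<in> negative_eigenvalues Q" for l
  proof -
    show "0 < - l * b" using m(2)[OF that] b by (simp add: mult_neg_pos)
    have "- l * b \<le> m * b" using m(2)[OF that] b(1) by (intro mult_right_mono) auto
    then show "- l * b \<le> 1 / (1 + \<xi>)" using b by simp
    also have "\<dots> < 1" using \<xi> by simp
    finally show "- l * b < 1" .
  qed
  have cs: "hinf_norm (comp_sens (tf_const (- b)) l) \<le> ereal K \<longleftrightarrow> (- l * b) / (1 - - l * b) \<le> K"
    if "l \<in> negative_eigenvalues Q" for l K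
  proof -
    have "comp_sens (tf_const (- b)) l = tf_const (l * - b / (1 - l * - b))"
      using lb[OF that] by (intro comp_sens_const) auto
    moreover have "0 \<le> (- l * b) / (1 - - l * b)" using lb[OF that] by (intro divide_nonneg_pos) auto
    moreover have "l * - b / (1 - l * - b) = (- l * b) / (1 - - l * b)" by simp
    ultimately show ?thesis by (simp only: hinf_norm_const abs_of_nonneg)
  qed
  have "tf_const (- b) \<noteq> 0" using b by (simp del: tf_const_hom)
  moreover have "stability_cond Q (tf_const (- b))"
  proof (rule stability_cond_const)
    fix l assume "l \<in> negative_eigenvalues Q"
    \<comment> \<open>Equality would mean \<open>- l * b = 1\<close>.\<close>
    from lb(3)[OF this] show "1 / - b \<noteq> l" using b(1) by (auto simp: field_simps)
  qed
  moreover have "robust_stability_cond Q (tf_const (- b)) \<xi>"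
    unfolding robust_stability_cond_def
  proof
    fix l assume l: "l \<in> negative_eigenvalues Q"
    have "(- l * b) * (1 + \<xi>) \<le> 1" using lb(2)[OF l] \<xi> by (simp add: pos_le_divide_eq)
    then have "(- l * b) / (1 - - l * b) \<le> 1 / \<xi>"
      using lb(3)[OF l] \<xi> by (simp add: divide_simps) (simp add: algebra_simps)
    then show "hinf_norm (comp_sens (tf_const (- b)) l) \<le> ereal (1 / \<xi>)" by (simp only: cs[OF l])
  qed
  moreover have "\<not> robust_stability_cond Q (tf_const (- b)) \<xi>'"
  proof
    assume "robust_stability_cond Q (tf_const (- b)) \<xi>'"
    then have "hinf_norm (comp_sens (tf_const (- b)) (- m)) \<le> ereal (1 / \<xi>')"
      using m(1) unfolding robust_stability_cond_def by (rule bspec)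
    then have "m * b / (1 - m * b) \<le> 1 / \<xi>'"
      unfolding cs[OF m(1)] by simp
    moreover have "m * b / (1 - m * b) = 1 / \<xi>" using \<xi> unfolding b(2) by (simp add: divide_simps)
    ultimately have "1 / \<xi> \<le> 1 / \<xi>'" by (simp only:)
    then show False using \<xi> by (simp add: divide_le_cancel field_simps)
  qed
  ultimately show ?thesis by blast
qed

theorem mainTheorem7:
  fixes t :: "'n::finite \<Rightarrow> 'n \<Rightarrow> real" and Q :: "real ^ 'n ^ 'n"
  assumes "\<And>i j. i \<noteq> j \<Longrightarrow> t i j = t j i \<and> 0 \<le> t i j"
    and "Q = - tie_line_matrix t"
  shows
    "(\<forall>(area :: 'n \<Rightarrow> lfc_area) (C :: 'n \<Rightarrow> tf) (H :: 'n \<Rightarrow> tf) (Hn :: tf) (\<xi> :: real).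
        (\<forall>i. admissible_area (area i) \<and> tf_proper (C i) \<and> H i = local_agent (area i) (C i)) \<and>
        Hn \<noteq> 0 \<and> 0 < \<xi> \<and> \<xi> < 1 \<and>
        stability_cond Q Hn \<and> robust_stability_cond Q Hn \<xi> \<and> model_matching_cond H Hn \<xi>
        \<longrightarrow>
        lfc_marginally_stable H Q \<and>
        (\<forall>z\<in>closed_rhp. tf_zero (char_fun H Q) z \<longrightarrow>
           (\<exists>l\<in>negative_eigenvalues Q. cmod (tf_eval (comp_sens Hn l) z) = 1 / \<xi>) \<and>
           (\<exists>i. cmod (tf_eval (rel_error Hn (H i)) z) = \<xi>)) \<and>
        ((\<forall>l\<in>negative_eigenvalues Q. hinf_norm (comp_sens Hn l) < ereal (1 / \<xi>)) \<or>
         (\<forall>i. hinf_norm (rel_error Hn (H i)) < ereal \<xi>)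
         \<longrightarrow> lfc_stable H Q))
     \<and>
     (\<exists>(area :: 'n \<Rightarrow> lfc_area) (C :: 'n \<Rightarrow> tf) (H :: 'n \<Rightarrow> tf) (Hn :: tf) (\<xi> :: real).
        (\<forall>i. admissible_area (area i) \<and> positive_params (area i) \<and> tf_proper (C i) \<and>
             H i = local_agent (area i) (C i)) \<and>
        Hn \<noteq> 0 \<and> 0 < \<xi> \<and> \<xi> < 1 \<and>
        stability_cond Q Hn \<and> robust_stability_cond Q Hn \<xi> \<and>
        (\<exists>i. \<not> hinf_norm (rel_error Hn (H i)) \<le> ereal \<xi>) \<and>
        lfc_stable H Q)
     \<and>
     (\<forall>\<xi> \<xi>' :: real. 0 < \<xi> \<and> \<xi> < \<xi>' \<and> \<xi>' < 1 \<longrightarrow>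
        (\<forall>(H :: 'n \<Rightarrow> tf) Hn. model_matching_cond H Hn \<xi> \<longrightarrow> model_matching_cond H Hn \<xi>') \<and>
        (\<forall>Hn. robust_stability_cond Q Hn \<xi>' \<longrightarrow> robust_stability_cond Q Hn \<xi>) \<and>
        (\<exists>(area :: 'n \<Rightarrow> lfc_area) (C :: 'n \<Rightarrow> tf) (H :: 'n \<Rightarrow> tf) (Hn :: tf).
           (\<forall>i. admissible_area (area i) \<and> positive_params (area i) \<and> tf_proper (C i) \<and>
                H i = local_agent (area i) (C i)) \<and>
           Hn \<noteq> 0 \<and> model_matching_cond H Hn \<xi>' \<and> \<not> model_matching_cond H Hn \<xi>) \<and>
        (negative_eigenvalues Q \<noteq> {} \<longrightarrow>
           (\<exists>Hn. Hn \<noteq> 0 \<and> stability_cond Q Hn \<and>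
              robust_stability_cond Q Hn \<xi> \<and> \<not> robust_stability_cond Q Hn \<xi>')))"
proof -
  have sym: "transpose Q = Q"
    using assms by (auto simp: vec_eq_iff transpose_def tie_line_matrix_def)
  have nsd: "v \<bullet> (Q *v v) \<le> 0" for v
    unfolding assms(2) using assms(1) by (rule tie_line_matrix_negative_semidefinite)
  \<comment> \<open>The diagonalisation yields finiteness of the set of negative eigenvalues, so
    that a smallest one exists in the trade-off part.\<close>
  obtain P d where "orthogonal_matrix P" "Q = P ** diag_mat d ** transpose P"
    using symmetric_matrix_diagonalization[OF sym] .
  note fin = diagonalization_negative_eigenvalues(1)[OF this]
  have fin: "finite (negative_eigenvalues Q)" unfolding fin by simp

  have sufficient: "\<forall>(area :: 'n \<Rightarrow> lfc_area) (C :: 'n \<Rightarrow> tf) (H :: 'n \<Rightarrow> tf) (Hn :: tf) (\<xi> :: real).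
        (\<forall>i. admissible_area (area i) \<and> tf_proper (C i) \<and> H i = local_agent (area i) (C i)) \<and>
        Hn \<noteq> 0 \<and> 0 < \<xi> \<and> \<xi> < 1 \<and>
        stability_cond Q Hn \<and> robust_stability_cond Q Hn \<xi> \<and> model_matching_cond H Hn \<xi>
        \<longrightarrow>
        lfc_marginally_stable H Q \<and>
        (\<forall>z\<in>closed_rhp. tf_zero (char_fun H Q) z \<longrightarrow>
           (\<exists>l\<in>negative_eigenvalues Q. cmod (tf_eval (comp_sens Hn l) z) = 1 / \<xi>) \<and>
           (\<exists>i. cmod (tf_eval (rel_error Hn (H i)) z) = \<xi>)) \<and>
        ((\<forall>l\<in>negative_eigenvalues Q. hinf_norm (comp_sens Hn l) < ereal (1 / \<xi>)) \<or>
         (\<forall>i. hinf_norm (rel_error Hn (H i)) < ereal \<xi>)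
         \<longrightarrow> lfc_stable H Q)"
  proof (intro allI impI; elim conjE)
    fix area :: "'n \<Rightarrow> lfc_area" and C H :: "'n \<Rightarrow> tf" and Hn :: tf and \<xi> :: real
    assume "\<forall>i. admissible_area (area i) \<and> tf_proper (C i) \<and> H i = local_agent (area i) (C i)"
    then have H: "\<And>i. tf_tendsto (H i) 0" by (simp add: local_agent_tendsto_0)
    assume *: "Hn \<noteq> 0" "0 < \<xi>" "\<xi> < 1" "stability_cond Q Hn" "robust_stability_cond Q Hn \<xi>"
      "model_matching_cond H Hn \<xi>"
    note marg = nominal_model_marginal[OF sym nsd H *]
    note bd = nominal_model_boundary_zero[OF sym nsd H *]
    \<comment> \<open>A zero in the closed half-plane forces equality on both sides at once, so one
      uniformly strict bound on either side excludes it.\<close>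
    have "lfc_stable H Q"
      if "(\<forall>l\<in>negative_eigenvalues Q. hinf_norm (comp_sens Hn l) < ereal (1 / \<xi>)) \<or>
         (\<forall>i. hinf_norm (rel_error Hn (H i)) < ereal \<xi>)"
      unfolding lfc_stable_def
    proof (intro ballI notI)
      fix z assume z: "z \<in> closed_rhp" and "tf_zero (char_fun H Q) z"
      from bd[OF this] obtain l i where l: "l \<in> negative_eigenvalues Q"
        "cmod (tf_eval (comp_sens Hn l) z) = 1 / \<xi>" and i: "cmod (tf_eval (rel_error Hn (H i)) z) = \<xi>"
        by blast
      have "0 \<le> Re z" using z by (simp add: closed_rhp_def)
      with that l(1) have "cmod (tf_eval (comp_sens Hn l) z) < 1 / \<xi> \<or> cmod (tf_eval (rel_error Hn (H i)) z) < \<xi>"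
        using hinf_norm_lessD by blast
      then show False using l(2) i by simp
    qed
    then show "lfc_marginally_stable H Q \<and>
        (\<forall>z\<in>closed_rhp. tf_zero (char_fun H Q) z \<longrightarrow>
           (\<exists>l\<in>negative_eigenvalues Q. cmod (tf_eval (comp_sens Hn l) z) = 1 / \<xi>) \<and>
           (\<exists>i. cmod (tf_eval (rel_error Hn (H i)) z) = \<xi>)) \<and>
        ((\<forall>l\<in>negative_eigenvalues Q. hinf_norm (comp_sens Hn l) < ereal (1 / \<xi>)) \<or>
         (\<forall>i. hinf_norm (rel_error Hn (H i)) < ereal \<xi>)
         \<longrightarrow> lfc_stable H Q)"
      using marg bd by blast
  qed
  have mono_match: "model_matching_cond H Hn \<xi>'"
    if "\<xi> < \<xi>'" "model_matching_cond H Hn \<xi>" for \<xi> \<xi>' and H :: "'n \<Rightarrow> tf" and Hn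
    using that unfolding model_matching_cond_def by (meson ereal_less_eq(3) less_imp_le order_trans)
  have mono_rob: "robust_stability_cond Q Hn \<xi>"
    if "0 < \<xi>" "\<xi> < \<xi>'" "robust_stability_cond Q Hn \<xi>'" for \<xi> \<xi>' Hn
  proof -
    have "ereal (1 / \<xi>') \<le> ereal (1 / \<xi>)" using that by (simp add: frac_le)
    then show ?thesis using that(3) unfolding robust_stability_cond_def by (meson order_trans)
  qed
  show ?thesis
  proof (rule conjI[OF sufficient conjI[OF mismatch_not_necessary]], intro allI impI, elim conjE,
      intro conjI)
    fix \<xi> \<xi>' :: real
    assume \<xi>: "0 < \<xi>" "\<xi> < \<xi>'"
    show "\<forall>(H :: 'n \<Rightarrow> tf) Hn. model_matching_cond H Hn \<xi> \<longrightarrow> model_matching_cond H Hn \<xi>'"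
      using mono_match[OF \<xi>(2)] by blast
    show "\<forall>Hn. robust_stability_cond Q Hn \<xi>' \<longrightarrow> robust_stability_cond Q Hn \<xi>"
      using mono_rob[OF \<xi>] by blast
    show "\<exists>(area :: 'n \<Rightarrow> lfc_area) (C :: 'n \<Rightarrow> tf) (H :: 'n \<Rightarrow> tf) (Hn :: tf).
           (\<forall>i. admissible_area (area i) \<and> positive_params (area i) \<and> tf_proper (C i) \<and>
                H i = local_agent (area i) (C i)) \<and>
           Hn \<noteq> 0 \<and> model_matching_cond H Hn \<xi>' \<and> \<not> model_matching_cond H Hn \<xi>"
      using \<xi> by (rule matching_radius_strict)
    show "negative_eigenvalues Q \<noteq> {} \<longrightarrow>
           (\<exists>Hn. Hn \<noteq> 0 \<and> stability_cond Q Hn \<and>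
              robust_stability_cond Q Hn \<xi> \<and> \<not> robust_stability_cond Q Hn \<xi>')"
      using robustness_radius_strict[OF \<xi> _ fin] by blast
  qed
qed

end
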